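(* For every integer $n \ge 2$ there is a constant $C_n > 0$ depending only on $n$ such that the following holds. Let $F \subset \mathbb{Z}^2$ be a finite set with $|F| = n$ and $0 \in F$, let $\ell \ge 1$ be an integer, and let $E \subset \mathbb{Z}^2$ be an $\ell\mathbb{Z}^2$-periodic set. Then there exist a finite index subgroup (lattice) $\Lambda$ of $\ell \mathbb{Z}^2$ with index $$[\ell\mathbb{Z}^2 : \Lambda] \le C_{|F|}\, \mathrm{diam}(F)^{2(|F|-1)^2},$$ an integer $m$ with $1 \le m \le |F|-1$, non-zero pairwise incommensurable vectors $h_1, \dots, h_m \in \mathbb{Z}^2$ with $$\|h_1\|, \dots, \|h_m\| \le \mathrm{diam}(F)^{|F|-1},$$ each $h_j$ being an integer multiple of a vector in $F \setminus \{0\}$, and a positive integer $L$ with $$L \le C_{|F|}\, \mathrm{diam}(F)^{|F|(|F|-1)},$$ such that for every $A \subset \mathbb{Z}^2$ with $\mathbf{1}_F * \mathbf{1}_A = \mathbf{1}_E$ (i.e. every level one tiling $A$ of $E$ by $F$) and every coset $x+\Lambda$ of $\Lambda$ in $\mathbb{Z}^2$, the set $A \cap (x + \Lambda)$ is $\langle \ell L h_j \rangle$-periodic for some $j \in \{1,\dots,m\}$. (Thus $\Lambda, m, L, h_1,\dots,h_m$ may depend on $E, \ell, F$ but not otherwise on $A$.)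
   Context: $\mathbf{1}_S$ is the indicator function of $S$; $f*g(x) = \sum_{y \in \mathbb{Z}^2} f(y)g(x-y)$. A set $S\subset \mathbb{Z}^2$ is $\Gamma$-periodic, for a subgroup $\Gamma \le \mathbb{Z}^2$, if $\mathbf{1}_S(x+\gamma) = \mathbf{1}_S(x)$ for all $x\in\mathbb{Z}^2$, $\gamma \in \Gamma$. $\langle h \rangle = \{nh : n \in \mathbb{Z}\}$. $\|\cdot\|$ is the Euclidean length and $\mathrm{diam}(F)$ is the Euclidean diameter of $F$. Two vectors are commensurable if one is a scalar multiple of the other, and incommensurable otherwise. *)

theory Defs
  imports "HOL-Analysis.Analysis" "HOL-Algebra.Coset"
begin

text \<open>The plane lattice is the type \<^typ>\<open>int \<times> int\<close> with its componentwise addition.\<close>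

definition Z2 :: "(int \<times> int) monoid"
  where "Z2 = \<lparr>carrier = UNIV, mult = (+), one = 0\<rparr>"

lemma comm_group_Z2: "comm_group Z2"
proof (rule comm_groupI)
  fix x assume "x \<in> carrier Z2"
  have "(- x) \<otimes>\<^bsub>Z2\<^esub> x = \<one>\<^bsub>Z2\<^esub>" by (simp add: Z2_def)
  then show "\<exists>y\<in>carrier Z2. y \<otimes>\<^bsub>Z2\<^esub> x = \<one>\<^bsub>Z2\<^esub>"
    by (rule bexI) (simp add: Z2_def)
qed (auto simp: Z2_def algebra_simps)

definition zscale :: "int \<Rightarrow> int \<times> int \<Rightarrow> int \<times> int"  (infixr "*\<^sub>Z" 75)
  where "k *\<^sub>Z v = (k * fst v, k * snd v)"

definition scaled_lattice :: "int \<Rightarrow> (int \<times> int) set"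
  where "scaled_lattice l = range (\<lambda>v. l *\<^sub>Z v)"

lemma subgroup_scaled_lattice: "subgroup (scaled_lattice l) Z2"
proof -
  interpret comm_group Z2 by (rule comm_group_Z2)
  show ?thesis
  proof (rule subgroupI)
    fix a assume "a \<in> scaled_lattice l"
    then obtain v where v: "a = l *\<^sub>Z v" by (auto simp: scaled_lattice_def)
    have "inv\<^bsub>Z2\<^esub> a = l *\<^sub>Z (- v)"
      by (rule inv_equality) (auto simp: Z2_def v zscale_def zero_prod_def)
    then show "inv\<^bsub>Z2\<^esub> a \<in> scaled_lattice l" by (auto simp: scaled_lattice_def)
  next
    fix a b assume "a \<in> scaled_lattice l" "b \<in> scaled_lattice l"
    then obtain v w where "a = l *\<^sub>Z v" "b = l *\<^sub>Z w" by (auto simp: scaled_lattice_def)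
    then have "a \<otimes>\<^bsub>Z2\<^esub> b = l *\<^sub>Z (v + w)"
      by (simp add: Z2_def zscale_def algebra_simps)
    then show "a \<otimes>\<^bsub>Z2\<^esub> b \<in> scaled_lattice l" by (auto simp: scaled_lattice_def)
  qed (auto simp: Z2_def scaled_lattice_def)
qed

definition cyclic_span :: "int \<times> int \<Rightarrow> (int \<times> int) set"
  where "cyclic_span h = range (\<lambda>k. k *\<^sub>Z h)"

definition periodic :: "(int \<times> int) set \<Rightarrow> (int \<times> int) set \<Rightarrow> bool"
  where "periodic \<Gamma> S \<longleftrightarrow>
    (\<forall>x. \<forall>\<gamma>\<in>\<Gamma>. (indicator S (x + \<gamma>) :: real) = indicator S x)"

definition conv :: "(int \<times> int \<Rightarrow> real) \<Rightarrow> (int \<times> int \<Rightarrow> real) \<Rightarrow> int \<times> int \<Rightarrow> real"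
  where "conv f g x = (\<Sum>\<^sub>\<infinity>y. f y * g (x - y))"

text \<open>Inclusion into the Euclidean plane: the norm of \<^typ>\<open>real \<times> real\<close> is the Euclidean one.\<close>

definition emb :: "int \<times> int \<Rightarrow> real \<times> real"
  where "emb v = (real_of_int (fst v), real_of_int (snd v))"

definition diam :: "(int \<times> int) set \<Rightarrow> real"
  where "diam F = diameter (emb ` F)"

definition commensurable :: "int \<times> int \<Rightarrow> int \<times> int \<Rightarrow> bool"
  where "commensurable v w \<longleftrightarrow>
    (\<exists>c::real. emb v = c *\<^sub>R emb w) \<or> (\<exists>c::real. emb w = c *\<^sub>R emb v)"

text \<open>The library has no index of a subgroup: it is the number of cosets. As \<^const>\<open>card\<close> is 0 on
  infinite sets, finiteness of the index has to be required separately.\<close>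

definition finite_index_subgroup :: "(int \<times> int) set \<Rightarrow> (int \<times> int) set \<Rightarrow> bool"
  where "finite_index_subgroup \<Lambda> G \<longleftrightarrow>
    subgroup \<Lambda> (Z2\<lparr>carrier := G\<rparr>) \<and> finite (rcosets\<^bsub>Z2\<lparr>carrier := G\<rparr>\<^esub> \<Lambda>)"

definition subgroup_index :: "(int \<times> int) set \<Rightarrow> (int \<times> int) set \<Rightarrow> nat"
  where "subgroup_index G \<Lambda> = card (rcosets\<^bsub>Z2\<lparr>carrier := G\<rparr>\<^esub> \<Lambda>)"

end

theory Submission
  imports Defs "HOL-Number_Theory.Number_Theory"
begin

text \<open>Write \<open>r F\<close> for the dilation of \<open>F\<close> by an integer \<open>r\<close>.

  The first ingredient is that a tiling of \<open>E\<close> by \<open>F\<close> is also a tiling of \<open>E\<close> by \<open>r F\<close> for all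
  \<open>r = 1 + q k\<close>, \<open>k \<ge> 0\<close>, where \<open>q = l * fact (card F)\<close> (lemma \<open>tiling_dilation\<close>). Modulo a prime
  \<open>p > card F\<close>, the \<open>p\<close>-fold convolution power of \<open>F\<close> is the indicator function of \<open>p F\<close>, so that
  \<open>p F * A\<close> is invariant under \<open>l\<int>\<^sup>2\<close> modulo \<open>p\<close>; its values are too small for the
  congruence not to be an equality. This step can be iterated over the prime factors of \<open>r\<close>.
  Averaging over large boxes shows that the invariant function obtained is the indicator function of
  \<open>E\<close>.

  Averaging the dilated equations over \<open>k\<close> gives
  \<open>indicator E - indicator A = (\<Sum>f\<in>F - {0}. \<phi> f)\<close> with nonnegative functions \<open>\<phi> f\<close> that are
  invariant under \<open>q f\<close> (lemma \<open>tiling_decomposition\<close>). The functions of parallel \<open>f\<close> are added up,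
  which leaves one function for each direction \<open>h\<close>, invariant under \<open>P h\<close> with \<open>P\<close> a
  multiple of \<open>q\<close>. The vectors \<open>h 1, \<dots>, h m\<close> are simply elements of \<open>F\<close>, one from each direction.

  The rest concerns such a sum of functions on one coset of \<open>\<Lambda> = P K \<int>\<^sup>2\<close>, where \<open>K\<close> is a common multiple
  of the determinants of pairs of directions. Two observations replace the equidistribution theory
  that the polynomial structure of the summands suggests. Comparing two parallel lines shows that each
  summand takes at most one positive value on the coset (lemma \<open>positive_values_equal\<close>). Moving two
  points independently shows that, if two summands are nonzero somewhere on the coset, all values are
  less than \<open>1\<close> (lemma \<open>distinct_sum_le_1\<close>). If only one summand is nonzero, it is invariant in its own
  direction and there is nothing more to do. Otherwise, since the sum is integral, each summand is modulo
  \<open>1\<close> a polynomial of degree less than \<open>card F\<close>; a polynomial modulo \<open>1\<close> with two values in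
  \<open>[0, 1)\<close> is a recursive sequence with at most \<open>2 ^ card F\<close> states, so it is periodic with a period bounded in
  terms of \<open>card F\<close> only (lemma \<open>two_valued_sequence_periodic\<close>). Hence one \<open>L\<close> serves for all \<open>A\<close>.\<close>

section \<open>Vectors in the plane lattice\<close>

definition cross :: "int \<times> int \<Rightarrow> int \<times> int \<Rightarrow> int"
  where "cross u v = fst u * snd v - snd u * fst v"

lemma zscale_add_left: "(a + b) *\<^sub>Z v = a *\<^sub>Z v + b *\<^sub>Z v"
  by (simp add: zscale_def algebra_simps)

lemma zscale_add_right: "a *\<^sub>Z (v + w) = a *\<^sub>Z v + a *\<^sub>Z w"
  by (simp add: zscale_def algebra_simps)

lemma zscale_zscale: "a *\<^sub>Z b *\<^sub>Z v = (a * b) *\<^sub>Z v"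
  by (simp add: zscale_def algebra_simps)

lemma zscale_zero [simp]: "0 *\<^sub>Z v = 0"
  by (simp add: zscale_def zero_prod_def)

lemma zscale_one [simp]: "1 *\<^sub>Z v = v"
  by (simp add: zscale_def)

lemma cross_self [simp]: "cross v v = 0"
  by (simp add: cross_def)

lemma cross_commute_zero: "cross u v = 0 \<longleftrightarrow> cross v u = 0"
  by (auto simp: cross_def algebra_simps)

text \<open>Cramer's rule without denominators. It shows that a multiple of \<open>cross u v\<close> carries every
  lattice vector into the lattice spanned by \<open>u\<close> and \<open>v\<close>; this is why the scale
  of \<open>\<Lambda>\<close> contains the determinants of all pairs of directions.\<close>

lemma cramer: "cross u v *\<^sub>Z w = cross w v *\<^sub>Z u + cross u w *\<^sub>Z v"
  by (simp add: zscale_def cross_def prod_eq_iff algebra_simps)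

lemma split_along:
  assumes "cross u v dvd K"
  shows "\<exists>a b. K *\<^sub>Z w = a *\<^sub>Z u + b *\<^sub>Z v"
proof -
  obtain c where "K = c * cross u v" using assms by (auto simp: dvd_def mult.commute)
  then have "K *\<^sub>Z w = (c * cross w v) *\<^sub>Z u + (c * cross u w) *\<^sub>Z v"
    by (metis cramer zscale_add_right zscale_zscale)
  then show ?thesis by blast
qed

lemma commensurable_iff_cross: "commensurable v w \<longleftrightarrow> cross v w = 0"
proof
  assume "commensurable v w"
  then obtain c :: real where
    "(real_of_int (fst v) = c * fst w \<and> real_of_int (snd v) = c * snd w) \<or>
     (real_of_int (fst w) = c * fst v \<and> real_of_int (snd w) = c * snd v)"
    by (auto simp: commensurable_def emb_def)
  then have "real_of_int (fst v) * snd w = snd v * fst w"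
    by (auto simp: algebra_simps)
  then show "cross v w = 0"
    by (metis cross_def diff_self of_int_eq_iff of_int_mult)
next
  assume "cross v w = 0"
  then have c: "real_of_int (fst v) * snd w = snd v * fst w"
    by (metis cross_def eq_iff_diff_eq_0 of_int_mult)
  consider "fst w \<noteq> 0" | "snd w \<noteq> 0" | "w = 0" by (auto simp: prod_eq_iff)
  then show "commensurable v w"
  proof cases
    case 1
    then have "emb v = (fst v / fst w) *\<^sub>R emb w"
      using c by (simp add: emb_def field_simps)
    then show ?thesis unfolding commensurable_def by blast
  next
    case 2
    then have "emb v = (snd v / snd w) *\<^sub>R emb w"
      using c by (simp add: emb_def field_simps)
    then show ?thesis unfolding commensurable_def by blast
  next
    case 3
    then have "emb w = 0 *\<^sub>R emb v" by (simp add: emb_def)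
    then show ?thesis unfolding commensurable_def by blast
  qed
qed

text \<open>The gcd of the coordinates says how many times \<open>f\<close> is longer than a primitive vector, and a
  vector parallel to \<open>f\<close> is an integer multiple of that primitive vector. A function invariant
  under several parallel steps \<open>q f\<close> is therefore invariant under one step \<open>q N h\<close> in their
  common direction.\<close>

lemma parallel_multiple:
  assumes "cross f h = 0" "gcd (fst f) (snd f) dvd N"
  shows "\<exists>k. N *\<^sub>Z h = k *\<^sub>Z f"
proof -
  obtain x y where xy: "x * fst f + y * snd f = gcd (fst f) (snd f)"
    using bezout_int by blast
  obtain c where c: "N = c * gcd (fst f) (snd f)"
    using assms(2) by (auto simp: dvd_def mult.commute)
  have eq: "fst f * snd h = snd f * fst h" using assms(1) by (simp add: cross_def)
  have "N * fst h = c * (x * fst h + y * snd h) * fst f"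
  proof -
    have "N * fst h = c * (x * fst f * fst h + y * (snd f * fst h))"
      unfolding c xy[symmetric] by (simp add: algebra_simps)
    also have "\<dots> = c * (x * fst h + y * snd h) * fst f"
      unfolding eq[symmetric] by (simp add: algebra_simps)
    finally show ?thesis .
  qed
  moreover have "N * snd h = c * (x * fst h + y * snd h) * snd f"
  proof -
    have "N * snd h = c * (x * (fst f * snd h) + y * snd f * snd h)"
      unfolding c xy[symmetric] by (simp add: algebra_simps)
    also have "\<dots> = c * (x * fst h + y * snd h) * snd f"
      unfolding eq by (simp add: algebra_simps)
    finally show ?thesis .
  qed
  ultimately show ?thesis
    by (intro exI[of _ "c * (x * fst h + y * snd h)"]) (simp add: zscale_def)
qed

lemma invariant_zscale:
  assumes "\<And>x. \<phi> (x + w) = \<phi> x"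
  shows "\<phi> (x + k *\<^sub>Z w) = \<phi> x"
proof (induction k arbitrary: x rule: int_induct[where k = 0])
  case base then show ?case by simp
next
  case (step1 i)
  have "x + (i + 1) *\<^sub>Z w = (x + w) + i *\<^sub>Z w" by (simp add: zscale_add_left ac_simps)
  then show ?case using step1 assms by metis
next
  case (step2 i)
  have "x + (i - 1) *\<^sub>Z w = (x - w) + i *\<^sub>Z w"
    by (simp add: zscale_def prod_eq_iff algebra_simps)
  moreover have "\<phi> (x - w) = \<phi> x" using assms[of "x - w"] by simp
  ultimately show ?case using step2 by metis
qed

lemma norm_emb: "norm (emb v) = sqrt ((fst v)\<^sup>2 + (snd v)\<^sup>2)"
  by (simp add: emb_def norm_Pair)

lemma norm_emb_sq: "(norm (emb v))\<^sup>2 = (fst v)\<^sup>2 + (snd v)\<^sup>2"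
  by (simp add: norm_emb)

lemma abs_cross_le: "\<bar>real_of_int (cross u v)\<bar> \<le> norm (emb u) * norm (emb v)"
proof (rule power2_le_imp_le)
  have "(cross u v)\<^sup>2 + (fst u * fst v + snd u * snd v)\<^sup>2
      = ((fst u)\<^sup>2 + (snd u)\<^sup>2) * ((fst v)\<^sup>2 + (snd v)\<^sup>2)"
    by (simp add: cross_def power2_eq_square algebra_simps)
  then have "(cross u v)\<^sup>2 \<le> ((fst u)\<^sup>2 + (snd u)\<^sup>2) * ((fst v)\<^sup>2 + (snd v)\<^sup>2)"
    by (metis le_add_same_cancel1 zero_le_power2)
  then have "real_of_int ((cross u v)\<^sup>2) \<le> real_of_int (((fst u)\<^sup>2 + (snd u)\<^sup>2) * ((fst v)\<^sup>2 + (snd v)\<^sup>2))"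
    by (rule of_int_le_iff[THEN iffD2])
  then show "\<bar>real_of_int (cross u v)\<bar>\<^sup>2 \<le> (norm (emb u) * norm (emb v))\<^sup>2"
    by (simp add: power_mult_distrib norm_emb_sq)
qed auto

lemma gcd_le_norm_emb:
  assumes "v \<noteq> 0"
  shows "real_of_int (gcd (fst v) (snd v)) \<le> norm (emb v)"
proof -
  have *: "\<bar>x\<bar> \<le> norm (emb v)" if "x = fst v \<or> x = snd v" for x :: int
    unfolding norm_emb using that
    by (auto intro!: real_le_rsqrt)
  consider "fst v \<noteq> 0" | "snd v \<noteq> 0" using assms by (auto simp: prod_eq_iff)
  then show ?thesis
  proof cases
    case 1
    then have "\<bar>gcd (fst v) (snd v)\<bar> \<le> \<bar>fst v\<bar>" by (intro dvd_imp_le_int) auto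
    then show ?thesis using *[of "fst v"] by linarith
  next
    case 2
    then have "\<bar>gcd (fst v) (snd v)\<bar> \<le> \<bar>snd v\<bar>" by (intro dvd_imp_le_int) auto
    then show ?thesis using *[of "snd v"] by linarith
  qed
qed

lemma one_le_norm_emb:
  assumes "v \<noteq> 0"
  shows "1 \<le> norm (emb v)"
proof -
  have "gcd (fst v) (snd v) > 0" using assms by (auto simp: prod_eq_iff)
  then have "1 \<le> real_of_int (gcd (fst v) (snd v))" by linarith
  then show ?thesis using gcd_le_norm_emb[OF assms] by linarith
qed

lemma norm_emb_le_diam:
  assumes "finite F" "0 \<in> F" "f \<in> F"
  shows "norm (emb f) \<le> diam F"
proof -
  have "dist (emb f) (emb 0) \<le> diameter (emb ` F)"
    using assms by (intro diameter_bounded_bound finite_imp_bounded) auto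
  then show ?thesis by (simp add: emb_def diam_def zero_prod_def[symmetric])
qed

text \<open>Taking each unordered pair only once is what gives the exponent: each of the
  \<open>card R * (card R - 1) / 2\<close> factors is at most \<open>d\<^sup>2\<close>. The induction adds the pairs of one new
  vector at a time.\<close>

lemma common_multiple_of_crosses:
  assumes "finite R" "pairwise (\<lambda>u v. cross u v \<noteq> 0) R" "\<And>u. u \<in> R \<Longrightarrow> norm (emb u) \<le> d"
  shows "\<exists>K::int. K > 0 \<and> (\<forall>u\<in>R. \<forall>v\<in>R. u \<noteq> v \<longrightarrow> cross u v dvd K) \<and>
    real_of_int K \<le> d ^ (card R * (card R - 1))"
  using assms
proof (induction R rule: finite_induct)
  case empty
  then show ?case by (intro exI[of _ 1]) simp
next
  case (insert r R)
  have "pairwise (\<lambda>u v. cross u v \<noteq> 0) R"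
    using insert.prems(1) by (rule pairwise_subset) blast
  then obtain K where K: "K > 0" "\<forall>u\<in>R. \<forall>v\<in>R. u \<noteq> v \<longrightarrow> cross u v dvd K"
    "real_of_int K \<le> d ^ (card R * (card R - 1))"
    using insert.IH insert.prems(2) by (metis insertCI)
  define P where "P = (\<Prod>u\<in>R. \<bar>cross r u\<bar>)"
  have ne: "cross r u \<noteq> 0" if "u \<in> R" for u
    using insert.prems(1) insert.hyps(2) that unfolding pairwise_insert by metis
  have "P > 0" unfolding P_def using ne by (auto intro!: prod_pos)
  have Pdvd: "cross r u dvd P" "cross u r dvd P" if "u \<in> R" for u
  proof -
    have "\<bar>cross r u\<bar> dvd P" unfolding P_def by (rule dvd_prodI[OF insert.hyps(1) that])
    moreover have "cross u r = - cross r u" by (simp add: cross_def)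
    ultimately show "cross r u dvd P" "cross u r dvd P" by simp_all
  qed
  have d0: "norm (emb r) \<le> d" using insert.prems(2) by simp
  then have "d \<ge> 0" by (rule order_trans[OF norm_ge_zero])
  have "real_of_int P = (\<Prod>u\<in>R. \<bar>real_of_int (cross r u)\<bar>)" by (simp add: P_def)
  also have "\<dots> \<le> (\<Prod>u\<in>R. d\<^sup>2)"
  proof (rule prod_mono, safe)
    fix u assume "(u::int \<times> int) \<in> R"
    then have "norm (emb u) \<le> d" using insert.prems(2) by simp
    then have "norm (emb r) * norm (emb u) \<le> d * d" using d0 \<open>d \<ge> 0\<close> by (intro mult_mono) auto
    then show "\<bar>real_of_int (cross r u)\<bar> \<le> d\<^sup>2"
      using abs_cross_le[of r u] by (simp add: power2_eq_square)
  qed auto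
  finally have Ple: "real_of_int P \<le> d ^ (2 * card R)" by (simp add: power_mult)
  have "real_of_int (K * P) \<le> d ^ (card R * (card R - 1)) * d ^ (2 * card R)"
    using K Ple \<open>P > 0\<close> \<open>d \<ge> 0\<close> by (auto intro!: mult_mono)
  also have "\<dots> = d ^ (card R * (card R - 1) + 2 * card R)" by (simp add: power_add)
  also have "card R * (card R - 1) + 2 * card R = card (insert r R) * (card (insert r R) - 1)"
    using insert.hyps by (cases "card R") auto
  finally have "real_of_int (K * P) \<le> d ^ (card (insert r R) * (card (insert r R) - 1))" .
  moreover have "\<forall>u\<in>insert r R. \<forall>v\<in>insert r R. u \<noteq> v \<longrightarrow> cross u v dvd K * P"
    using K(2) Pdvd by (auto intro: dvd_mult dvd_mult2)
  ultimately show ?case using K(1) \<open>P > 0\<close> by (intro exI[of _ "K * P"]) simp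
qed

lemma parallel_representatives:
  assumes "finite S" "0 \<notin> S"
  shows "\<exists>R\<subseteq>S. pairwise (\<lambda>u v. cross u v \<noteq> 0) R \<and> (\<forall>f\<in>S. \<exists>r\<in>R. cross f r = 0)"
  using assms
proof (induction S rule: finite_induct)
  case empty
  then show ?case by simp
next
  case (insert s S)
  then obtain R where R: "R \<subseteq> S" "pairwise (\<lambda>u v. cross u v \<noteq> 0) R" "\<forall>f\<in>S. \<exists>r\<in>R. cross f r = 0"
    by auto
  show ?case
  proof (cases "\<exists>r\<in>R. cross s r = 0")
    case True
    then show ?thesis using R by (intro exI[of _ R]) auto
  next
    case False
    then show ?thesis using R
      by (intro exI[of _ "insert s R"]) (auto simp: pairwise_insert cross_commute_zero[of _ s])
  qed
qed

section \<open>Telescoping sums of bounded sequences\<close>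

text \<open>Summing a bounded sequence over a long interval is insensitive to a shift. Together with
  \<open>zero_if_multiples_bounded\<close> this stands in for densities and means: a constant whose \<open>N\<close>-fold
  multiple telescopes to a bounded quantity vanishes.\<close>

lemma shift_sum_bound:
  fixes c :: "int \<Rightarrow> real"
  assumes c: "\<And>s. 0 \<le> c s" "\<And>s. c s \<le> 1"
  shows "\<bar>\<Sum>s<N. c (int s + w) - c (int s)\<bar> \<le> \<bar>real_of_int w\<bar>"
proof -
  have nonneg: "\<bar>\<Sum>s<N. c (int s + int k) - c (int s)\<bar> \<le> real k"
    if c: "\<And>s. 0 \<le> c s" "\<And>s. c s \<le> 1" for c and k :: nat
  proof (induction k)
    case (Suc k)
    have "(\<Sum>s<N. c (int s + int (Suc k)) - c (int s + int k)) = c (int N + int k) - c (int k)"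
      using sum_lessThan_telescope[of "\<lambda>s. c (int s + int k)" N] by (simp add: ac_simps)
    moreover have "\<bar>c (int N + int k) - c (int k)\<bar> \<le> 1"
      using c[of "int N + int k"] c[of "int k"] by linarith
    moreover have "(\<Sum>s<N. c (int s + int (Suc k)) - c (int s))
        = (\<Sum>s<N. c (int s + int (Suc k)) - c (int s + int k)) + (\<Sum>s<N. c (int s + int k) - c (int s))"
      by (simp add: sum.distrib[symmetric])
    ultimately show ?case using Suc.IH by linarith
  qed simp
  show ?thesis
  proof (cases "w \<ge> 0")
    case True
    then show ?thesis using nonneg[of c "nat w"] c by simp
  next
    case False
    have "(\<Sum>s<N. c (int s + w) - c (int s)) = - (\<Sum>s<N. c (int s + int (nat (- w)) + w) - c (int s + w))"
      using False by (simp add: sum_negf[symmetric])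
    moreover have "\<bar>\<Sum>s<N. c (int s + int (nat (- w)) + w) - c (int s + w)\<bar> \<le> real (nat (- w))"
      by (rule nonneg[of "\<lambda>s. c (s + w)"]) (use c in auto)
    ultimately show ?thesis using False by simp
  qed
qed

lemma zero_if_multiples_bounded:
  fixes t :: real
  assumes "\<And>N::nat. \<bar>real N * t\<bar> \<le> B"
  shows "t = 0"
proof (rule ccontr)
  assume "t \<noteq> 0"
  then obtain N :: nat where "B < real N * \<bar>t\<bar>"
    using reals_Archimedean3[of "\<bar>t\<bar>"] by auto
  then show False using assms[of N] by (simp add: abs_mult)
qed

section \<open>Dilating a tiling\<close>

text \<open>For \<open>r \<noteq> 0\<close> this is the convolution of \<open>a\<close> with the indicator function of \<open>r F\<close>.\<close>

definition dilate_sum ::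
    "(int \<times> int) set \<Rightarrow> int \<Rightarrow> (int \<times> int \<Rightarrow> int) \<Rightarrow> int \<times> int \<Rightarrow> int"
  where "dilate_sum F r a x = (\<Sum>f\<in>F. a (x - r *\<^sub>Z f))"

text \<open>The binomial theorem for the commuting operators ``shift by \<open>r f\<close>'' and \<open>dilate_sum F r\<close>.\<close>

lemma dilate_sum_insert_power:
  fixes a :: "int \<times> int \<Rightarrow> int"
  assumes "finite F" "f \<notin> F"
  shows "(dilate_sum (insert f F) r ^^ n) a x =
    (\<Sum>k\<le>n. int (n choose k) * (dilate_sum F r ^^ k) a (x - (int (n - k) * r) *\<^sub>Z f))"
proof (induction n arbitrary: x)
  case 0
  then show ?case by simp
next
  case (Suc n)
  let ?T = "dilate_sum F r"
  let ?y = "\<lambda>k. x - (int (Suc n - k) * r) *\<^sub>Z f"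
  let ?t = "\<lambda>k. (?T ^^ k) a (?y k)"
  have y: "x - r *\<^sub>Z f - (int (n - k) * r) *\<^sub>Z f = ?y k" if "k \<le> n" for k
    using that by (simp add: zscale_def prod_eq_iff of_nat_diff algebra_simps)
  have "(dilate_sum (insert f F) r ^^ Suc n) a x
      = (dilate_sum (insert f F) r ^^ n) a (x - r *\<^sub>Z f)
        + (\<Sum>g\<in>F. (dilate_sum (insert f F) r ^^ n) a (x - r *\<^sub>Z g))"
    using assms by (simp add: dilate_sum_def[of "insert f F"])
  also have "(dilate_sum (insert f F) r ^^ n) a (x - r *\<^sub>Z f) = (\<Sum>k\<le>n. int (n choose k) * ?t k)"
    unfolding Suc.IH by (rule sum.cong) (simp_all only: y atMost_iff)
  also have "(\<Sum>g\<in>F. (dilate_sum (insert f F) r ^^ n) a (x - r *\<^sub>Z g))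
      = (\<Sum>k\<le>n. int (n choose k) * (\<Sum>g\<in>F. (?T ^^ k) a (x - r *\<^sub>Z g - (int (n - k) * r) *\<^sub>Z f)))"
    unfolding Suc.IH by (subst sum.swap) (simp add: sum_distrib_left)
  also have "\<dots> = (\<Sum>k\<le>n. int (n choose k) * ?t (Suc k))"
    by (simp add: dilate_sum_def algebra_simps)
  also have "(\<Sum>k\<le>n. int (n choose k) * ?t k)
      = ?t 0 + (\<Sum>k\<le>n. int (n choose Suc k) * ?t (Suc k))"
  proof -
    have "(\<Sum>k\<le>n. int (n choose k) * ?t k) = (\<Sum>k\<le>Suc n. int (n choose k) * ?t k)"
      by (simp only: sum.atMost_Suc) (simp add: binomial_eq_0)
    also have "\<dots> = int (n choose 0) * ?t 0 + (\<Sum>k\<le>n. int (n choose Suc k) * ?t (Suc k))"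
      by (rule sum.atMost_Suc_shift)
    finally show ?thesis by simp
  qed
  also have "?t 0 + (\<Sum>k\<le>n. int (n choose Suc k) * ?t (Suc k))
        + (\<Sum>k\<le>n. int (n choose k) * ?t (Suc k))
      = int (Suc n choose 0) * ?t 0 + (\<Sum>k\<le>n. int (Suc n choose Suc k) * ?t (Suc k))"
    by (simp add: sum.distrib[symmetric] distrib_right add.commute del: funpow.simps)
  also have "\<dots> = (\<Sum>k\<le>Suc n. int (Suc n choose k) * ?t k)"
    by (rule sum.atMost_Suc_shift[symmetric])
  finally show ?case .
qed

text \<open>Modulo a prime \<open>p\<close> the \<open>p\<close>-th power of a sum of commuting shifts is the sum of their \<open>p\<close>-th
  powers, and the \<open>p\<close>-th power of the shift by \<open>r f\<close> is the shift by \<open>p r f\<close>.\<close>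

lemma dilate_sum_frobenius:
  assumes "prime p" "finite F"
  shows "[(dilate_sum F r ^^ p) a x = dilate_sum F (int p * r) a x] (mod int p)"
  using assms(2)
proof (induction F arbitrary: x rule: finite_induct)
  case empty
  have "p = Suc (p - 1)" using prime_gt_0_nat[OF assms(1)] by simp
  then have "(dilate_sum {} r ^^ p) a x = dilate_sum {} r ((dilate_sum {} r ^^ (p - 1)) a) x"
    by (metis comp_apply funpow.simps(2))
  then show ?case unfolding dilate_sum_def by simp
next
  case (insert f F)
  let ?t = "\<lambda>k. int (p choose k) * (dilate_sum F r ^^ k) a (x - (int (p - k) * r) *\<^sub>Z f)"
  have p: "p \<ge> 2" using assms(1) prime_ge_2_nat by blast
  have "[(\<Sum>k\<in>{0<..<p}. ?t k) = (\<Sum>k\<in>{0<..<p}. 0)] (mod int p)"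
  proof (rule cong_sum)
    fix k assume "k \<in> {0<..<p}"
    then have "int p dvd int (p choose k)" using dvd_choose_prime[of k p] assms(1) by auto
    then show "[?t k = 0] (mod int p)" by (simp add: cong_0_iff)
  qed
  then have mid: "[(\<Sum>k\<in>{0<..<p}. ?t k) = 0] (mod int p)" by simp
  have split: "{..p} = insert 0 (insert p {0<..<p})" using p by auto
  have "(dilate_sum (insert f F) r ^^ p) a x = (\<Sum>k\<le>p. ?t k)"
    by (rule dilate_sum_insert_power) (use insert in auto)
  also have "\<dots> = ?t 0 + ?t p + (\<Sum>k\<in>{0<..<p}. ?t k)"
    unfolding split using p by (subst sum.insert; simp)+
  also have "[\<dots> = a (x - (int p * r) *\<^sub>Z f) + dilate_sum F (int p * r) a x + 0] (mod int p)"
    by (intro cong_add mid) (use insert.IH in auto)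
  also have "a (x - (int p * r) *\<^sub>Z f) + dilate_sum F (int p * r) a x + 0
      = dilate_sum (insert f F) (int p * r) a x"
    using insert.hyps by (simp add: dilate_sum_def)
  finally show ?case .
qed

definition scale_invariant :: "int \<Rightarrow> (int \<times> int \<Rightarrow> 'b) \<Rightarrow> bool"
  where "scale_invariant l g \<longleftrightarrow> (\<forall>x v. g (x + l *\<^sub>Z v) = g x)"

lemma scale_invariant_dilate_sum:
  assumes "scale_invariant l g"
  shows "scale_invariant l (dilate_sum F r g)"
proof -
  have "g (x + l *\<^sub>Z v - c) = g (x - c)" for x v c
    using assms unfolding scale_invariant_def by (metis add_diff_eq add.commute)
  then show ?thesis by (simp add: scale_invariant_def dilate_sum_def)
qed

lemma dilate_sum_bounds:
  assumes "finite F" "\<And>x. 0 \<le> a x \<and> a x \<le> 1"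
  shows "0 \<le> dilate_sum F r a x" "dilate_sum F r a x \<le> int (card F)"
  using assms(2) sum_bounded_above[of F "\<lambda>f. a (x - r *\<^sub>Z f)" 1]
  unfolding dilate_sum_def by (metis sum_nonneg, metis mult.right_neutral)

text \<open>The \<open>p\<close>-fold sum inherits the invariance of the single sum, so by the Frobenius congruence the
  dilated sum is invariant modulo \<open>p\<close>. Its values lie between \<open>0\<close> and \<open>card F < p\<close>, so the
  congruence is an equality.\<close>

lemma dilate_sum_prime_step:
  assumes "finite F" "\<And>x. 0 \<le> a x \<and> a x \<le> 1"
    and p: "prime p" "card F < p"
    and inv: "scale_invariant l (dilate_sum F r a)"
  shows "scale_invariant l (dilate_sum F (int p * r) a)"
  unfolding scale_invariant_def
proof (intro allI)
  fix x v
  obtain m where m: "p = Suc m" using prime_gt_0_nat[OF p(1)] gr0_implies_Suc by blast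
  have "scale_invariant l ((dilate_sum F r ^^ j) (dilate_sum F r a))" for j
    by (induction j) (auto intro: inv scale_invariant_dilate_sum)
  then have "scale_invariant l ((dilate_sum F r ^^ p) a)"
    unfolding m by (simp add: funpow_swap1)
  then have "[dilate_sum F (int p * r) a (x + l *\<^sub>Z v) = dilate_sum F (int p * r) a x] (mod int p)"
    using dilate_sum_frobenius[OF p(1) assms(1)] unfolding scale_invariant_def
    by (metis cong_sym cong_trans)
  moreover have "0 \<le> dilate_sum F (int p * r) a y \<and> dilate_sum F (int p * r) a y < int p" for y
    using dilate_sum_bounds[OF assms(1), of a "int p * r" y, OF assms(2)] p(2) by linarith
  ultimately show "dilate_sum F (int p * r) a (x + l *\<^sub>Z v) = dilate_sum F (int p * r) a x"
    using cong_less_imp_eq_int by blast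
qed

lemma dilate_sum_coprime_invariant:
  assumes "finite F" "\<And>x. 0 \<le> a x \<and> a x \<le> 1"
    and "scale_invariant l (dilate_sum F 1 a)"
    and "coprime r (fact (card F))" "r > 0"
  shows "scale_invariant l (dilate_sum F (int r) a)"
  using assms(4,5)
proof (induction r rule: less_induct)
  case (less r)
  show ?case
  proof (cases "r = 1")
    case True
    then show ?thesis using assms(3) by simp
  next
    case False
    then obtain p where p: "prime p" "p dvd r" using prime_factor_nat by blast
    then obtain s where s: "r = p * s" by (auto simp: dvd_def)
    have "\<not> p dvd fact (card F)"
      using less.prems(1) p by (metis coprime_common_divisor_nat not_prime_1)
    then have "card F < p" using prime_dvd_fact_iff[OF p(1)] by simp
    have "s < r" using s less.prems(2) prime_gt_1_nat[OF p(1)] by simp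
    moreover have "coprime s (fact (card F))" using less.prems(1) s by simp
    moreover have "s > 0" using s less.prems(2) by simp
    ultimately have "scale_invariant l (dilate_sum F (int s) a)" by (rule less.IH)
    then show ?thesis
      unfolding s using dilate_sum_prime_step[OF assms(1,2) p(1) \<open>card F < p\<close>] by simp
  qed
qed

text \<open>A shift changes the sum over an \<open>N \<times> N\<close> box only along the boundary of the box.\<close>

lemma box_shift_bound:
  fixes b :: "int \<times> int \<Rightarrow> real"
  assumes b: "\<And>x. 0 \<le> b x" "\<And>x. b x \<le> 1"
  shows "\<bar>\<Sum>i<N. \<Sum>j<N. b (x + l *\<^sub>Z ((int i, int j) + w)) - b (x + l *\<^sub>Z (int i, int j))\<bar>
    \<le> real N * (\<bar>real_of_int (fst w)\<bar> + \<bar>real_of_int (snd w)\<bar>)"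
proof -
  define c where "c i j = b (x + l *\<^sub>Z (i, j))" for i j
  have c: "0 \<le> c i j" "c i j \<le> 1" for i j using b by (auto simp: c_def)
  have "b (x + l *\<^sub>Z ((int i, int j) + w)) = c (int i + fst w) (int j + snd w)" for i j
    by (simp add: c_def plus_prod_def)
  then have "(\<Sum>i<N. \<Sum>j<N. b (x + l *\<^sub>Z ((int i, int j) + w)) - b (x + l *\<^sub>Z (int i, int j)))
      = (\<Sum>i<N. \<Sum>j<N. (c (int i + fst w) (int j + snd w) - c (int i + fst w) (int j))
          + (c (int i + fst w) (int j) - c (int i) (int j)))"
    by (simp add: c_def)
  also have "\<dots> = (\<Sum>i<N. \<Sum>j<N. c (int i + fst w) (int j + snd w) - c (int i + fst w) (int j))
      + (\<Sum>j<N. \<Sum>i<N. c (int i + fst w) (int j) - c (int i) (int j))"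
    by (simp only: sum.distrib) (rule arg_cong[OF sum.swap])
  finally have eq: "(\<Sum>i<N. \<Sum>j<N. b (x + l *\<^sub>Z ((int i, int j) + w)) - b (x + l *\<^sub>Z (int i, int j)))
      = (\<Sum>i<N. \<Sum>j<N. c (int i + fst w) (int j + snd w) - c (int i + fst w) (int j))
      + (\<Sum>j<N. \<Sum>i<N. c (int i + fst w) (int j) - c (int i) (int j))" .
  have "\<bar>\<Sum>i<N. \<Sum>j<N. c (int i + fst w) (int j + snd w) - c (int i + fst w) (int j)\<bar>
      \<le> (\<Sum>i<N. \<bar>real_of_int (snd w)\<bar>)"
    by (rule order_trans[OF sum_abs], intro sum_mono shift_sum_bound c)
  moreover have "\<bar>\<Sum>j<N. \<Sum>i<N. c (int i + fst w) (int j) - c (int i) (int j)\<bar>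
      \<le> (\<Sum>j<N. \<bar>real_of_int (fst w)\<bar>)"
    by (rule order_trans[OF sum_abs], intro sum_mono shift_sum_bound[where c = "\<lambda>i. c i _"] c)
  ultimately show ?thesis unfolding eq by (simp add: algebra_simps)
qed

text \<open>The two sums differ only by shifts of \<open>a\<close> by vectors of \<open>l\<int>\<^sup>2\<close>, so over a large box
  inside a coset of \<open>l\<int>\<^sup>2\<close> their difference adds up to a boundary term. But the difference is constant
  on that coset, hence zero.\<close>

lemma dilate_sum_eq:
  assumes "finite F" and a: "\<And>x. 0 \<le> a x \<and> a x \<le> 1"
    and inv: "scale_invariant l (dilate_sum F 1 a)" "scale_invariant l (dilate_sum F (1 + l * k) a)"
  shows "dilate_sum F (1 + l * k) a x = dilate_sum F 1 a x"
proof -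
  let ?r = "1 + l * k"
  let ?D = "\<lambda>x. real_of_int (dilate_sum F ?r a x - dilate_sum F 1 a x)"
  define B where "B = (\<Sum>f\<in>F. \<bar>real_of_int (fst ((- k) *\<^sub>Z f))\<bar> + \<bar>real_of_int (snd ((- k) *\<^sub>Z f))\<bar>)"
  have bound: "\<bar>real N * ?D x\<bar> \<le> B" for N :: nat
  proof (cases "N = 0")
    case True
    then show ?thesis by (auto simp: B_def intro!: sum_nonneg)
  next
    case False
    have arg: "y - ?r *\<^sub>Z f = (y' - f) + l *\<^sub>Z (z + (- k) *\<^sub>Z f)" if "y = y' + l *\<^sub>Z z" for y y' z f
      unfolding that by (simp add: zscale_def prod_eq_iff algebra_simps)
    have "real N * (real N * ?D x) = (\<Sum>i<N. \<Sum>j<N. ?D (x + l *\<^sub>Z (int i, int j)))"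
    proof -
      have "dilate_sum F ?r a (x + l *\<^sub>Z v) = dilate_sum F ?r a x"
        "dilate_sum F 1 a (x + l *\<^sub>Z v) = dilate_sum F 1 a x" for v
        using inv unfolding scale_invariant_def by blast+
      then show ?thesis by simp
    qed
    also have "\<dots> = (\<Sum>i<N. \<Sum>j<N. \<Sum>f\<in>F. real_of_int (a (x - f + l *\<^sub>Z ((int i, int j) + (- k) *\<^sub>Z f)))
        - a (x - f + l *\<^sub>Z (int i, int j)))"
      unfolding dilate_sum_def arg[OF refl]
      by (simp add: sum_subtractf algebra_simps)
    also have "\<dots> = (\<Sum>f\<in>F. \<Sum>i<N. \<Sum>j<N. real_of_int (a (x - f + l *\<^sub>Z ((int i, int j) + (- k) *\<^sub>Z f)))
        - a (x - f + l *\<^sub>Z (int i, int j)))"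
      by (subst (2) sum.swap, subst sum.swap) (rule refl)
    finally have "\<bar>real N * (real N * ?D x)\<bar>
        \<le> (\<Sum>f\<in>F. \<bar>\<Sum>i<N. \<Sum>j<N. real_of_int (a (x - f + l *\<^sub>Z ((int i, int j) + (- k) *\<^sub>Z f)))
          - a (x - f + l *\<^sub>Z (int i, int j))\<bar>)"
      by (simp only: sum_abs)
    also have "\<dots> \<le> (\<Sum>f\<in>F. real N *
        (\<bar>real_of_int (fst ((- k) *\<^sub>Z f))\<bar> + \<bar>real_of_int (snd ((- k) *\<^sub>Z f))\<bar>))"
      by (intro sum_mono box_shift_bound) (use a in auto)
    also have "\<dots> = real N * B" by (simp add: B_def sum_distrib_left)
    finally show ?thesis using False by (simp add: abs_mult)
  qed
  have "?D x = 0" by (rule zero_if_multiples_bounded) (rule bound)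
  then show ?thesis by simp
qed

text \<open>The factor \<open>fact (card F)\<close> makes the dilation \<open>r\<close> coprime to all primes up to \<open>card F\<close>, so \<open>r\<close> is
  a product of primes to which the Frobenius argument applies; the factor \<open>l\<close> lets the box average
  identify the resulting invariant function.\<close>

lemma tiling_dilation:
  assumes F: "finite F" and a: "\<And>x. 0 \<le> a x \<and> a x \<le> 1"
    and inv: "scale_invariant l (dilate_sum F 1 a)" and l: "l \<ge> 1"
  shows "dilate_sum F (1 + l * fact (card F) * int k) a x = dilate_sum F 1 a x"
proof -
  let ?m = "fact (card F) :: nat"
  have r: "1 + l * fact (card F) * int k = int (1 + ?m * (nat l * k))"
    using l by (simp add: algebra_simps)
  have "coprime (1 + ?m * (nat l * k)) ?m"
    by (rule coprimeI) (metis dvd_add_left_iff dvd_mult2)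
  then have "scale_invariant l (dilate_sum F (int (1 + ?m * (nat l * k))) a)"
    by (intro dilate_sum_coprime_invariant F a inv) simp_all
  then have "scale_invariant l (dilate_sum F (1 + l * (fact (card F) * int k)) a)"
    unfolding r[symmetric] by (simp add: mult.assoc)
  from dilate_sum_eq[OF F a inv this, of x] show ?thesis by (simp add: mult.assoc)
qed

section \<open>Averaging over dilations\<close>

text \<open>The function \<open>\<phi> f x\<close> is a limit of the averages of \<open>a (x - (1 + q k) f)\<close> over
  \<open>0 \<le> k \<le> N\<close>. Adding \<open>q f\<close> to \<open>x\<close> shifts \<open>k\<close> by one, which does not change the limit. As there are only
  countably many pairs \<open>(f, x)\<close>, one subsequence of the averages converges for all of them at once.\<close>

lemma averages_over_dilations:
  fixes a u :: "int \<times> int \<Rightarrow> real"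
  assumes F: "finite F" and a: "\<And>x. 0 \<le> a x" "\<And>x. a x \<le> 1"
    and eq: "\<And>(k::nat) x. (\<Sum>f\<in>F. a (x - (1 + q * int k) *\<^sub>Z f)) = u x"
  shows "\<exists>\<phi>. (\<forall>f x. 0 \<le> \<phi> f x) \<and> (\<forall>f x. \<phi> f (x + q *\<^sub>Z f) = \<phi> f x) \<and>
    (\<forall>x. (\<Sum>f\<in>F. \<phi> f x) = u x)"
proof -
  define g :: "nat \<Rightarrow> (int \<times> int) \<times> (int \<times> int) \<Rightarrow> real"
    where "g N z = (\<Sum>k<Suc N. a (snd z - (1 + q * int k) *\<^sub>Z fst z)) / real (Suc N)" for N z
  define K :: "((int \<times> int) \<times> (int \<times> int) \<Rightarrow> real) set" where "K = PiE UNIV (\<lambda>_. {0..1})"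
  have "compactin (product_topology (\<lambda>_. euclidean) UNIV) K"
    unfolding K_def by (simp add: compactin_PiE)
  then have "compact K" by (simp add: euclidean_product_topology)
  then have K: "seq_compact K" by (rule compact_imp_seq_compact)
  have g: "g N \<in> K" for N
  proof -
    have "0 \<le> g N z" for z unfolding g_def by (intro divide_nonneg_nonneg sum_nonneg a) simp
    moreover have "g N z \<le> 1" for z
      using sum_bounded_above[of "{..<Suc N}" "\<lambda>k. a (snd z - (1 + q * int k) *\<^sub>Z fst z)" 1] a(2)
      unfolding g_def by (simp add: divide_le_eq_1 del: sum.lessThan_Suc)
    ultimately show ?thesis by (auto simp: K_def)
  qed
  obtain \<psi> r where \<psi>: "\<psi> \<in> K" "strict_mono r" "(g \<circ> r) \<longlonglongrightarrow> \<psi>"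
    using K g unfolding seq_compact_def by metis
  have lim: "(\<lambda>N. g (r N) z) \<longlonglongrightarrow> \<psi> z" for z
    using continuous_on_tendsto_compose[OF continuous_on_product_coordinates[of z] \<psi>(3)]
    by simp
  have inv: "\<psi> (f, x + q *\<^sub>Z f) = \<psi> (f, x)" for f x
  proof -
    define c where "c s = a (x - (1 + q * s) *\<^sub>Z f)" for s
    have "\<bar>g N (f, x + q *\<^sub>Z f) - g N (f, x)\<bar> \<le> inverse (real (Suc N))" for N
    proof -
      have arg: "x + q *\<^sub>Z f - (1 + q * s) *\<^sub>Z f = x - (1 + q * (s + (- 1))) *\<^sub>Z f" for s
        by (simp add: zscale_def prod_eq_iff algebra_simps)
      have "g N (f, x + q *\<^sub>Z f) - g N (f, x)
          = (\<Sum>k<Suc N. c (int k + (- 1)) - c (int k)) / real (Suc N)"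
        unfolding g_def fst_conv snd_conv arg c_def by (simp add: diff_divide_distrib sum_subtractf)
      moreover have "\<bar>\<Sum>k<Suc N. c (int k + (- 1)) - c (int k)\<bar> \<le> \<bar>real_of_int (- 1)\<bar>"
        by (rule shift_sum_bound) (simp_all add: c_def a)
      ultimately show ?thesis by (simp add: abs_divide inverse_eq_divide divide_right_mono)
    qed
    then have "\<forall>\<^sub>F N in sequentially.
        norm (g (r N) (f, x + q *\<^sub>Z f) - g (r N) (f, x)) \<le> inverse (real (Suc (r N)))"
      by simp
    moreover have "(\<lambda>N. inverse (real (Suc (r N)))) \<longlonglongrightarrow> 0"
      using LIMSEQ_subseq_LIMSEQ[OF LIMSEQ_inverse_real_of_nat \<psi>(2)] by (simp add: o_def)
    ultimately have "(\<lambda>N. g (r N) (f, x + q *\<^sub>Z f) - g (r N) (f, x)) \<longlonglongrightarrow> 0"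
      by (rule Lim_null_comparison)
    moreover have "(\<lambda>N. g (r N) (f, x + q *\<^sub>Z f) - g (r N) (f, x))
        \<longlonglongrightarrow> \<psi> (f, x + q *\<^sub>Z f) - \<psi> (f, x)"
      by (intro tendsto_diff lim)
    ultimately have "\<psi> (f, x + q *\<^sub>Z f) - \<psi> (f, x) = 0" using LIMSEQ_unique by blast
    then show ?thesis by simp
  qed
  have sum: "(\<Sum>f\<in>F. \<psi> (f, x)) = u x" for x
  proof -
    have "(\<Sum>f\<in>F. g N (f, x)) = u x" for N
    proof -
      have "(\<Sum>f\<in>F. g N (f, x))
          = (\<Sum>k<Suc N. \<Sum>f\<in>F. a (x - (1 + q * int k) *\<^sub>Z f)) / real (Suc N)"
        unfolding g_def fst_conv snd_conv sum_divide_distrib[symmetric] by (subst sum.swap) (rule refl)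
      also have "\<dots> = u x" unfolding eq by simp
      finally show ?thesis .
    qed
    then have "(\<lambda>N. \<Sum>f\<in>F. g (r N) (f, x)) \<longlonglongrightarrow> u x" by simp
    moreover have "(\<lambda>N. \<Sum>f\<in>F. g (r N) (f, x)) \<longlonglongrightarrow> (\<Sum>f\<in>F. \<psi> (f, x))"
      by (intro tendsto_sum lim)
    ultimately show ?thesis using LIMSEQ_unique by blast
  qed
  have "0 \<le> \<psi> z" for z using \<psi>(1) by (auto simp: K_def PiE_def)
  then show ?thesis using inv sum by (intro exI[of _ "\<lambda>f x. \<psi> (f, x)"]) auto
qed

section \<open>Iterated differences\<close>

definition difference :: "'a::plus \<Rightarrow> ('a \<Rightarrow> real) \<Rightarrow> 'a \<Rightarrow> real"
  where "difference v f x = f (x + v) - f x"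

text \<open>Each function \<open>\<theta> k\<close> is killed by the difference with step \<open>w k\<close>, while \<open>\<psi>\<close> does not distinguish
  the steps \<open>w k\<close> from \<open>v\<close>. Taking the differences for all \<open>k\<close> in turn removes the whole sum and
  leaves an iterated difference of \<open>\<psi>\<close> alone: modulo \<open>1\<close>, \<open>\<psi>\<close> is a polynomial in
  the direction \<open>v\<close>.\<close>

lemma iterated_difference_Ints:
  fixes \<psi> :: "'a::ab_semigroup_add \<Rightarrow> real" and \<theta> :: "'k \<Rightarrow> 'a \<Rightarrow> real"
  assumes "finite S"
    and "\<And>x. \<psi> x + (\<Sum>k\<in>S. \<theta> k x) \<in> \<int>"
    and "\<And>k x. k \<in> S \<Longrightarrow> \<theta> k (x + w k) = \<theta> k x"
    and "\<And>k x. k \<in> S \<Longrightarrow> \<psi> (x + w k) = \<psi> (x + v)"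
  shows "(difference v ^^ card S) \<psi> x \<in> \<int>"
  using assms
proof (induction S arbitrary: \<psi> \<theta> x rule: finite_induct)
  case empty
  then show ?case by simp
next
  case (insert k S)
  have "(difference v ^^ card S) (difference v \<psi>) x \<in> \<int>"
  proof (rule insert.IH[where \<theta> = "\<lambda>j. difference (w k) (\<theta> j)"])
    fix x
    have "\<theta> k (x + w k) = \<theta> k x" "\<psi> (x + w k) = \<psi> (x + v)" using insert.prems by auto
    then have "difference v \<psi> x + (\<Sum>j\<in>S. difference (w k) (\<theta> j) x)
        = (\<psi> (x + w k) + (\<Sum>j\<in>insert k S. \<theta> j (x + w k))) - (\<psi> x + (\<Sum>j\<in>insert k S. \<theta> j x))"
      using insert.hyps by (simp add: difference_def sum_subtractf)
    then show "difference v \<psi> x + (\<Sum>j\<in>S. difference (w k) (\<theta> j) x) \<in> \<int>"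
      using insert.prems(1) by (metis Ints_diff)
  next
    fix j x assume j: "j \<in> S"
    have "\<theta> j (x + w j + w k) = \<theta> j (x + w k)"
      using insert.prems(2)[of j "x + w k"] j by (simp add: ac_simps)
    then show "difference (w k) (\<theta> j) (x + w j) = difference (w k) (\<theta> j) x"
      using insert.prems(2)[of j x] j by (simp add: difference_def)
    have "\<psi> (x + w j + v) = \<psi> (x + v + v)"
      using insert.prems(3)[of j "x + v"] j by (simp add: ac_simps)
    then show "difference v \<psi> (x + w j) = difference v \<psi> (x + v)"
      using insert.prems(3)[of j x] j by (simp add: difference_def)
  qed
  then show ?case using insert.hyps by (simp add: funpow_swap1)
qed

lemma iterated_difference_diff:
  fixes f g :: "'a::plus \<Rightarrow> real"
  shows "(difference v ^^ d) (\<lambda>x. f x - g x) x = (difference v ^^ d) f x - (difference v ^^ d) g x"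
  by (induction d arbitrary: x) (auto simp: difference_def)

lemma iterated_difference_shift:
  fixes f :: "'a::ab_semigroup_add \<Rightarrow> real"
  shows "(difference v ^^ d) (\<lambda>x. f (x + c)) x = (difference v ^^ d) f (x + c)"
  by (induction d arbitrary: x) (auto simp: difference_def ac_simps)

lemma iterated_difference_line:
  "(difference 1 ^^ d) (\<lambda>t. f (y + t *\<^sub>Z v)) t = (difference v ^^ d) f (y + t *\<^sub>Z v)"
  by (induction d arbitrary: t) (auto simp: difference_def zscale_add_left ac_simps)

text \<open>A sequence that is a polynomial of degree below \<open>d\<close> modulo \<open>1\<close> is determined modulo \<open>1\<close> by
  \<open>d\<close> consecutive values; this is the case of \<open>d\<close> zeros.\<close>

lemma Ints_of_difference_Ints:
  fixes e :: "int \<Rightarrow> real"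
  assumes "\<And>t. (difference 1 ^^ d) e t \<in> \<int>" "\<And>i. i < d \<Longrightarrow> e (t0 + int i) = 0"
  shows "e t \<in> \<int>"
  using assms
proof (induction d arbitrary: e t)
  case 0
  then show ?case by simp
next
  case (Suc d)
  have step: "difference 1 e t \<in> \<int>" for t
  proof (rule Suc.IH)
    show "(difference 1 ^^ d) (difference 1 e) t \<in> \<int>" for t
      using Suc.prems(1)[of t] by (simp add: funpow_swap1)
    show "difference 1 e (t0 + int i) = 0" if "i < d" for i
      using Suc.prems(2)[of i] Suc.prems(2)[of "Suc i"] that by (simp add: difference_def ac_simps)
  qed
  show ?case
  proof (induction t rule: int_induct[where k = t0])
    case base
    then show ?case using Suc.prems(2)[of 0] by simp
  next
    case (step1 i)
    have "e (i + 1) = e i + difference 1 e i" by (simp add: difference_def)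
    then show ?case using step[of i] step1 by (metis Ints_add)
  next
    case (step2 i)
    have "e (i - 1) = e i - difference 1 e (i - 1)" by (simp add: difference_def)
    then show ?case using step[of "i - 1"] step2 by (metis Ints_diff)
  qed
qed

text \<open>As \<open>c < 1\<close>, the two values are distinct modulo \<open>1\<close>. So any \<open>d\<close> consecutive
  values of \<open>b\<close> determine all of \<open>b\<close>. There are \<open>2 ^ d\<close> possible windows, so two of the first
  \<open>2 ^ d + 1\<close> windows agree, and their distance is a period. The factorial is a common multiple of
  all distances that can occur.\<close>

lemma two_valued_sequence_periodic:
  fixes b :: "int \<Rightarrow> real"
  assumes b: "\<And>t. b t \<in> {0, c}" and c: "0 < c" "c < 1"
    and diff: "\<And>t. (difference 1 ^^ d) b t \<in> \<int>" and "d \<le> n"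
  shows "b (t + fact (2 ^ n)) = b t"
proof -
  define W where "W t = restrict (\<lambda>i. b (int t + int i)) {..<d}" for t :: nat
  have "W ` {..2 ^ d} \<subseteq> PiE {..<d} (\<lambda>_. {0, c})"
    unfolding W_def image_subset_iff by (intro ballI restrict_PiE_iff[THEN iffD2] b)
  then have "card (W ` {..2 ^ d}) \<le> card (PiE {..<d} (\<lambda>_. {0, c}))"
    by (intro card_mono finite_PiE) auto
  also have "\<dots> = 2 ^ d" using c by (simp add: card_PiE numeral_2_eq_2)
  also have "\<dots> < card {..(2::nat) ^ d}" by simp
  finally have "\<not> inj_on W {..2 ^ d}" by (rule pigeonhole)
  then obtain t1 t2 where t12: "t1 < t2" "t2 \<le> 2 ^ d" "W t1 = W t2"
    unfolding inj_on_def by (metis atMost_iff linorder_neqE_nat)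
  define \<tau> where "\<tau> = t2 - t1"
  \<comment> \<open>The difference of \<open>b\<close> and its shift by \<open>\<tau>\<close> vanishes on a window, so it is integral everywhere; it is
    also smaller than \<open>1\<close>.\<close>
  define e where "e s = b (s + int \<tau>) - b s" for s
  have window: "e (int t1 + int i) = 0" if "i < d" for i
    using fun_cong[OF t12(3), of i] that t12(1) by (simp add: W_def e_def \<tau>_def ac_simps of_nat_diff)
  have "(difference 1 ^^ d) e s \<in> \<int>" for s
    unfolding e_def iterated_difference_diff iterated_difference_shift by (intro Ints_diff diff)
  then have "e s \<in> \<int>" for s using Ints_of_difference_Ints window by blast
  moreover have "\<bar>e s\<bar> < 1" for s using b[of s] b[of "s + int \<tau>"] c by (auto simp: e_def)
  ultimately have "e s = 0" for s using Ints_nonzero_abs_less1 by blast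
  then have step: "b (s + int \<tau>) = b s" for s by (simp add: e_def)
  have mult: "b (t + int k * int \<tau>) = b t" for k
  proof (induction k)
    case (Suc k)
    then show ?case using step[of "t + int k * int \<tau>"] by (simp add: algebra_simps)
  qed simp
  have "\<tau> \<le> 2 ^ d" using t12 by (simp add: \<tau>_def)
  also have "\<dots> \<le> 2 ^ n" using \<open>d \<le> n\<close> by (simp add: power_increasing)
  finally have "\<tau> dvd fact (2 ^ n)" using t12 by (intro dvd_fact) (auto simp: \<tau>_def)
  then obtain k where "fact (2 ^ n) = k * \<tau>" by (auto simp: dvd_def mult.commute)
  then have "(fact (2 ^ n) :: int) = int k * int \<tau>" by (metis of_nat_fact of_nat_mult)
  then show ?thesis using mult by simp
qed

section \<open>Sums of invariant functions with values 0 and 1\<close>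

text \<open>The situation on which the structure theorem rests, stripped of the tiling: finitely many
  nonnegative functions, one per direction, each invariant under \<open>P\<close> times its own direction,
  add up to an indicator function. The number \<open>K\<close> is such that each vector of \<open>P K \<int>\<^sup>2\<close> splits
  into invariant steps of any two of the functions.\<close>

locale invariant_decomposition =
  fixes R :: "(int \<times> int) set" and \<phi> :: "int \<times> int \<Rightarrow> int \<times> int \<Rightarrow> real" and P K :: int
  assumes finite: "finite R"
    and nonneg: "0 \<le> \<phi> h x"
    and invariant: "h \<in> R \<Longrightarrow> \<phi> h (x + P *\<^sub>Z h) = \<phi> h x"
    and cross_dvd: "h \<in> R \<Longrightarrow> k \<in> R \<Longrightarrow> h \<noteq> k \<Longrightarrow> cross h k dvd K"
    and sum_01: "(\<Sum>h\<in>R. \<phi> h x) \<in> {0, 1}"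
begin

lemma invariant_multiple: "h \<in> R \<Longrightarrow> \<phi> h (x + (a * P) *\<^sub>Z h) = \<phi> h x"
  using invariant_zscale[of "\<phi> h" "P *\<^sub>Z h"] invariant by (simp add: zscale_zscale)

lemma split_step:
  assumes "h \<in> R" "k \<in> R" "h \<noteq> k"
  shows "\<exists>a b. (P * K) *\<^sub>Z v = (a * P) *\<^sub>Z h + (b * P) *\<^sub>Z k"
proof -
  obtain a b where "K *\<^sub>Z v = a *\<^sub>Z h + b *\<^sub>Z k"
    using split_along cross_dvd[OF assms] by blast
  then have "(P * K) *\<^sub>Z v = P *\<^sub>Z (a *\<^sub>Z h + b *\<^sub>Z k)" by (simp add: zscale_zscale[symmetric])
  then show ?thesis by (metis mult.commute zscale_add_right zscale_zscale)
qed

lemma sum_le_1: "H \<subseteq> R \<Longrightarrow> (\<Sum>h\<in>H. \<phi> h x) \<le> 1"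
  using sum_mono2[OF finite, of H "\<lambda>h. \<phi> h x"] nonneg sum_01[of x] by fastforce

lemma le_1: "h \<in> R \<Longrightarrow> \<phi> h x \<le> 1"
  using sum_le_1[of "{h}" x] by simp

text \<open>By splitting the vector from one point to the other into a step that \<open>\<phi> h\<close> ignores and one
  that \<open>\<phi> k\<close> ignores, both values are attained at a single point.\<close>

lemma distinct_sum_le_1:
  assumes "h \<in> R" "k \<in> R" "h \<noteq> k"
  shows "\<phi> h y + \<phi> k (y + (P * K) *\<^sub>Z v) \<le> 1"
proof -
  obtain a b where ab: "(P * K) *\<^sub>Z v = (a * P) *\<^sub>Z h + (b * P) *\<^sub>Z k"
    using split_step[OF assms] by blast
  let ?z = "y + (a * P) *\<^sub>Z h"
  have "\<phi> k (y + (P * K) *\<^sub>Z v) = \<phi> k ?z"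
    unfolding ab add.assoc[symmetric] by (rule invariant_multiple[OF assms(2)])
  moreover have "\<phi> h ?z = \<phi> h y" by (rule invariant_multiple[OF assms(1)])
  moreover have "(\<Sum>i\<in>{h, k}. \<phi> i ?z) \<le> 1" by (rule sum_le_1) (use assms in auto)
  ultimately show ?thesis using assms(3) by simp
qed

text \<open>Where \<open>\<phi> h\<close> is positive the total is \<open>1\<close>, so on the line through \<open>y\<close> in direction \<open>h\<close> the other
  functions add up to the constant \<open>1 - \<phi> h y\<close>, and similarly on the parallel line through the second
  point. But each of the other functions takes the same values on both lines up to a shift, so the sums
  over long segments of the two lines differ by a bounded amount, which forces the two constants to
  agree.\<close>

lemma positive_values_equal:
  assumes h: "h \<in> R" and pos: "\<phi> h y > 0" "\<phi> h (y + (P * K) *\<^sub>Z v) > 0"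
  shows "\<phi> h (y + (P * K) *\<^sub>Z v) = \<phi> h y"
proof -
  let ?y' = "y + (P * K) *\<^sub>Z v"
  have "\<exists>b. \<forall>s. \<phi> i (?y' + (s * P) *\<^sub>Z h) = \<phi> i (y + ((s + b) * P) *\<^sub>Z h)" if i: "i \<in> R - {h}" for i
  proof -
    obtain a b where ab: "(P * K) *\<^sub>Z v = (a * P) *\<^sub>Z i + (b * P) *\<^sub>Z h"
      using split_step i h by blast
    have "?y' + (s * P) *\<^sub>Z h = (y + ((s + b) * P) *\<^sub>Z h) + (a * P) *\<^sub>Z i" for s
      unfolding ab by (simp add: zscale_def prod_eq_iff algebra_simps)
    then have "\<phi> i (?y' + (s * P) *\<^sub>Z h) = \<phi> i (y + ((s + b) * P) *\<^sub>Z h)" for s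
      using invariant_multiple[of i "y + ((s + b) * P) *\<^sub>Z h" a] i by (metis DiffD1)
    then show ?thesis by blast
  qed
  then obtain \<sigma> where \<sigma>:
    "\<phi> i (?y' + (s * P) *\<^sub>Z h) = \<phi> i (y + ((s + \<sigma> i) * P) *\<^sub>Z h)" if "i \<in> R - {h}" for i s
    by metis
  have rest: "(\<Sum>i\<in>R - {h}. \<phi> i (z + (s * P) *\<^sub>Z h)) = 1 - \<phi> h z" if "\<phi> h z > 0" for z s
  proof -
    have split: "(\<Sum>i\<in>R. \<phi> i (z + (s * P) *\<^sub>Z h)) = \<phi> h z + (\<Sum>i\<in>R - {h}. \<phi> i (z + (s * P) *\<^sub>Z h))"
      using finite h by (simp add: sum.remove[of R h] invariant_multiple)
    moreover have "(\<Sum>i\<in>R - {h}. \<phi> i (z + (s * P) *\<^sub>Z h)) \<ge> 0" by (intro sum_nonneg nonneg)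
    ultimately show ?thesis using that sum_01[of "z + (s * P) *\<^sub>Z h"] by auto
  qed
  have "\<bar>real N * (\<phi> h y - \<phi> h ?y')\<bar> \<le> (\<Sum>i\<in>R - {h}. \<bar>real_of_int (\<sigma> i)\<bar>)" for N :: nat
  proof -
    let ?c = "\<lambda>i s. \<phi> i (y + (s * P) *\<^sub>Z h)"
    have "(\<Sum>i\<in>R - {h}. ?c i (int s + \<sigma> i) - ?c i (int s)) = \<phi> h y - \<phi> h ?y'" for s
    proof -
      have "(\<Sum>i\<in>R - {h}. ?c i (int s + \<sigma> i)) = (\<Sum>i\<in>R - {h}. \<phi> i (?y' + (int s * P) *\<^sub>Z h))"
        by (rule sum.cong) (auto simp: \<sigma>)
      then show ?thesis using rest[OF pos(1)] rest[OF pos(2)] by (simp add: sum_subtractf)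
    qed
    then have "real N * (\<phi> h y - \<phi> h ?y') = (\<Sum>s<N. \<Sum>i\<in>R - {h}. ?c i (int s + \<sigma> i) - ?c i (int s))"
      by simp
    also have "\<dots> = (\<Sum>i\<in>R - {h}. \<Sum>s<N. ?c i (int s + \<sigma> i) - ?c i (int s))" by (rule sum.swap)
    finally have "\<bar>real N * (\<phi> h y - \<phi> h ?y')\<bar>
        \<le> (\<Sum>i\<in>R - {h}. \<bar>\<Sum>s<N. ?c i (int s + \<sigma> i) - ?c i (int s)\<bar>)"
      by (simp only: sum_abs)
    also have "\<dots> \<le> (\<Sum>i\<in>R - {h}. \<bar>real_of_int (\<sigma> i)\<bar>)"
    proof (rule sum_mono)
      fix i assume "i \<in> R - {h}"
      then show "\<bar>\<Sum>s<N. ?c i (int s + \<sigma> i) - ?c i (int s)\<bar> \<le> \<bar>real_of_int (\<sigma> i)\<bar>"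
        using shift_sum_bound[of "?c i" "\<sigma> i" N] nonneg le_1 by simp
    qed
    finally show ?thesis .
  qed
  then have "\<phi> h y - \<phi> h ?y' = 0" by (rule zero_if_multiples_bounded)
  then show ?thesis by simp
qed

text \<open>Along the direction \<open>h\<close>, the function \<open>\<phi> g\<close> takes at most one positive value, and modulo \<open>1\<close> it
  is a polynomial because the total is integral and the other functions can be differenced away.\<close>

lemma component_periodic:
  assumes g: "g \<in> R" and n: "card R \<le> n"
    and less_1: "\<And>t. \<phi> g (y + t *\<^sub>Z (P * K) *\<^sub>Z h) < 1"
  shows "\<phi> g (y + fact (2 ^ n) *\<^sub>Z (P * K) *\<^sub>Z h) = \<phi> g y"
proof -
  define v where "v = (P * K) *\<^sub>Z h"
  define b where "b t = \<phi> g (y + t *\<^sub>Z v)" for t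
  have "\<exists>w. (\<forall>x. \<phi> k (x + w) = \<phi> k x) \<and> (\<forall>x. \<phi> g (x + w) = \<phi> g (x + v))" if k: "k \<in> R - {g}" for k
  proof -
    obtain c d where cd: "(P * K) *\<^sub>Z h = (c * P) *\<^sub>Z k + (d * P) *\<^sub>Z g"
      using split_step k g by blast
    have "\<phi> g (x + (c * P) *\<^sub>Z k) = \<phi> g (x + v)" for x
      unfolding v_def cd add.assoc[symmetric] using invariant_multiple[OF g] by simp
    then show ?thesis using invariant_multiple[of k] k by blast
  qed
  then obtain w where w: "\<And>k x. k \<in> R - {g} \<Longrightarrow> \<phi> k (x + w k) = \<phi> k x"
    "\<And>k x. k \<in> R - {g} \<Longrightarrow> \<phi> g (x + w k) = \<phi> g (x + v)"
    by metis
  have "(difference v ^^ card (R - {g})) (\<phi> g) x \<in> \<int>" for x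
  proof (rule iterated_difference_Ints[where \<theta> = \<phi> and w = w])
    show "\<phi> g x + (\<Sum>k\<in>R - {g}. \<phi> k x) \<in> \<int>" for x
      using sum_01[of x] sum.remove[OF finite g, of "\<lambda>k. \<phi> k x"] by auto
  qed (use finite w in auto)
  then have diff: "(difference 1 ^^ card (R - {g})) b t \<in> \<int>" for t
    unfolding b_def iterated_difference_line .
  have "card (R - {g}) \<le> n" using n card_Diff1_le[of R g] by linarith
  have step: "y + t *\<^sub>Z v = (y + s *\<^sub>Z v) + (P * K) *\<^sub>Z ((t - s) *\<^sub>Z h)" for s t
    by (simp add: v_def zscale_def prod_eq_iff algebra_simps)
  have "b (0 + fact (2 ^ n)) = b 0"
  proof (cases "\<exists>s. b s > 0")
    case True
    then obtain s where s: "b s > 0" by blast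
    have "b t \<in> {0, b s}" for t
    proof (cases "b t = 0")
      case False
      then have "b t > 0" using nonneg[of g] by (simp add: b_def order_less_le)
      then show ?thesis using positive_values_equal[OF g, of "y + s *\<^sub>Z v" "(t - s) *\<^sub>Z h"] s
        unfolding b_def step[of t s, symmetric] by simp
    qed simp
    moreover have "b s < 1" using less_1 by (simp add: b_def v_def)
    ultimately show ?thesis
      using two_valued_sequence_periodic s diff \<open>card (R - {g}) \<le> n\<close> by blast
  next
    case False
    then show ?thesis using nonneg[of g] unfolding b_def by (metis order_less_le)
  qed
  then show ?thesis by (simp add: b_def v_def)
qed

text \<open>If two of the functions are nonzero somewhere on the coset, then \<open>distinct_sum_le_1\<close> keeps all
  values below \<open>1\<close>, so all functions are periodic in every direction. Otherwise the sum is a single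
  function, which is invariant in its own direction, and \<open>h\<close> has to be that direction.\<close>

lemma sum_periodic_on_coset:
  assumes "R \<noteq> {}" and n: "card R \<le> n"
  shows "\<exists>h\<in>R. \<forall>v. (\<Sum>g\<in>R. \<phi> g (x + (P * K) *\<^sub>Z v + fact (2 ^ n) *\<^sub>Z (P * K) *\<^sub>Z h))
    = (\<Sum>g\<in>R. \<phi> g (x + (P * K) *\<^sub>Z v))"
proof -
  let ?pt = "\<lambda>v. x + (P * K) *\<^sub>Z v"
  have shift: "?pt v + t *\<^sub>Z (P * K) *\<^sub>Z h = ?pt (v + t *\<^sub>Z h)" for v t h
    by (simp add: zscale_def prod_eq_iff algebra_simps)
  show ?thesis
  proof (cases "\<exists>h\<in>R. \<exists>k\<in>R. h \<noteq> k \<and> (\<exists>v. \<phi> h (?pt v) > 0) \<and> (\<exists>v. \<phi> k (?pt v) > 0)")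
    case True
    then obtain h k v w where hk: "h \<in> R" "k \<in> R" "h \<noteq> k" "\<phi> h (?pt v) > 0" "\<phi> k (?pt w) > 0"
      by blast
    have less_1: "\<phi> g (?pt z) < 1" if "g \<in> R" for g z
    proof -
      obtain j y where j: "j \<in> R" "j \<noteq> g" "\<phi> j (?pt y) > 0" using hk by metis
      have "?pt z = ?pt y + (P * K) *\<^sub>Z (z - y)"
        by (simp add: zscale_def prod_eq_iff algebra_simps)
      then have "\<phi> j (?pt y) + \<phi> g (?pt z) \<le> 1"
        using distinct_sum_le_1[OF j(1) that j(2), of "?pt y" "z - y"] by metis
      then show ?thesis using j(3) by linarith
    qed
    have "\<phi> g (?pt v + fact (2 ^ n) *\<^sub>Z (P * K) *\<^sub>Z h) = \<phi> g (?pt v)" if "g \<in> R" for g v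
      using component_periodic[OF that n, of "?pt v" h] less_1[OF that] by (simp only: shift)
    then show ?thesis using hk(1) by (intro bexI[of _ h]) auto
  next
    case False
    obtain h where h: "h \<in> R" "\<And>k v. k \<in> R - {h} \<Longrightarrow> \<phi> k (?pt v) = 0"
    proof (cases "\<exists>h\<in>R. \<exists>v. \<phi> h (?pt v) > 0")
      case True
      then show ?thesis using that False nonneg by (metis DiffD1 DiffD2 insertI1 order_less_le)
    next
      case False
      then show ?thesis using that nonneg \<open>R \<noteq> {}\<close> by (metis DiffD1 all_not_in_conv order_less_le)
    qed
    have only: "(\<Sum>g\<in>R. \<phi> g (?pt v)) = \<phi> h (?pt v)" for v
      using h(2) by (simp add: sum.remove[OF finite h(1)])
    have "\<phi> h (?pt v + fact (2 ^ n) *\<^sub>Z (P * K) *\<^sub>Z h) = \<phi> h (?pt v)" for v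
      using invariant_multiple[OF h(1), of "?pt v" "fact (2 ^ n) * K"]
      by (simp add: zscale_zscale ac_simps)
    then show ?thesis
      using h(1) unfolding shift only by blast
  qed
qed

end

section \<open>Index of scaled lattices\<close>

lemma scaled_lattice_subset: "scaled_lattice (l * B) \<subseteq> scaled_lattice l"
  by (auto simp: scaled_lattice_def zscale_zscale[symmetric])

lemma subgroup_scaled_lattice_in:
  "subgroup (scaled_lattice (l * B)) (Z2\<lparr>carrier := scaled_lattice l\<rparr>)"
proof -
  interpret comm_group Z2 by (rule comm_group_Z2)
  show ?thesis
    by (intro subgroup_incl subgroup_scaled_lattice scaled_lattice_subset)
qed

text \<open>Reducing both coordinates modulo \<open>B\<close> gives a representative of each coset.\<close>

lemma rcosets_scaled_lattice:
  assumes "B > 0"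
  shows "rcosets\<^bsub>Z2\<lparr>carrier := scaled_lattice l\<rparr>\<^esub> (scaled_lattice (l * B))
    \<subseteq> (\<lambda>w. (\<lambda>v. v + l *\<^sub>Z w) ` scaled_lattice (l * B)) ` ({0..<B} \<times> {0..<B})"
proof
  fix X assume "X \<in> rcosets\<^bsub>Z2\<lparr>carrier := scaled_lattice l\<rparr>\<^esub> (scaled_lattice (l * B))"
  then obtain w where w: "X = (\<lambda>v. v + l *\<^sub>Z w) ` scaled_lattice (l * B)"
    by (auto simp: RCOSETS_def r_coset_def scaled_lattice_def Z2_def)
  let ?r = "(fst w mod B, snd w mod B)"
  let ?d = "(fst w div B, snd w div B)"
  have eq: "l *\<^sub>Z w = (l * B) *\<^sub>Z ?d + l *\<^sub>Z ?r"
  proof -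
    have "w = B *\<^sub>Z ?d + ?r" by (simp add: zscale_def prod_eq_iff)
    then show ?thesis by (metis zscale_add_right zscale_zscale)
  qed
  have "range (\<lambda>v. (l * B) *\<^sub>Z v + l *\<^sub>Z w) = range (\<lambda>v. (l * B) *\<^sub>Z v + l *\<^sub>Z ?r)"
  proof (intro equalityI subsetI; elim rangeE)
    fix x v assume "x = (l * B) *\<^sub>Z v + l *\<^sub>Z w"
    then have "x = (l * B) *\<^sub>Z (v + ?d) + l *\<^sub>Z ?r"
      unfolding eq zscale_add_right by (simp only: add.assoc)
    then show "x \<in> range (\<lambda>v. (l * B) *\<^sub>Z v + l *\<^sub>Z ?r)" by blast
  next
    fix x v assume "x = (l * B) *\<^sub>Z v + l *\<^sub>Z ?r"
    then have "x = (l * B) *\<^sub>Z (v - ?d) + l *\<^sub>Z w"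
      unfolding eq by (simp add: zscale_def prod_eq_iff algebra_simps)
    then show "x \<in> range (\<lambda>v. (l * B) *\<^sub>Z v + l *\<^sub>Z w)" by blast
  qed
  then have "X = (\<lambda>v. v + l *\<^sub>Z ?r) ` scaled_lattice (l * B)"
    unfolding w scaled_lattice_def image_image .
  moreover have "?r \<in> {0..<B} \<times> {0..<B}" using assms by simp
  ultimately show "X \<in> (\<lambda>w. (\<lambda>v. v + l *\<^sub>Z w) ` scaled_lattice (l * B)) ` ({0..<B} \<times> {0..<B})"
    by blast
qed

lemma finite_index_scaled_lattice:
  assumes "B > 0"
  shows "finite_index_subgroup (scaled_lattice (l * B)) (scaled_lattice l)"
  unfolding finite_index_subgroup_def
  using subgroup_scaled_lattice_in finite_subset[OF rcosets_scaled_lattice[OF assms]] by simp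

lemma index_scaled_lattice_le:
  assumes "B > 0"
  shows "real (subgroup_index (scaled_lattice l) (scaled_lattice (l * B))) \<le> (real_of_int B)\<^sup>2"
proof -
  have "subgroup_index (scaled_lattice l) (scaled_lattice (l * B)) \<le> card ({0..<B} \<times> {0..<B})"
    unfolding subgroup_index_def by (rule surj_card_le[OF _ rcosets_scaled_lattice[OF assms]]) simp
  also have "\<dots> = nat B * nat B" by (simp add: card_cartesian_product)
  finally have "real (subgroup_index (scaled_lattice l) (scaled_lattice (l * B))) \<le> real (nat B * nat B)"
    by (simp only: of_nat_le_iff)
  then show ?thesis using assms by (simp add: power2_eq_square)
qed

section \<open>From tilings to decompositions\<close>

lemma periodic_scaled_lattice_iff:
  "periodic (scaled_lattice l) S \<longleftrightarrow> (\<forall>x v. x + l *\<^sub>Z v \<in> S \<longleftrightarrow> x \<in> S)"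
  by (auto simp: periodic_def scaled_lattice_def indicator_eq_1_iff indicator_def split: if_splits)

lemma periodic_cyclic_spanI:
  assumes "\<And>x. x + w \<in> S \<longleftrightarrow> x \<in> S"
  shows "periodic (cyclic_span w) S"
  using invariant_zscale[of "\<lambda>x. x \<in> S" w] assms
  by (auto simp: periodic_def cyclic_span_def indicator_def)

lemma conv_indicator:
  assumes "finite F"
  shows "conv (indicator F) (indicator A) x = (\<Sum>f\<in>F. indicator A (x - f))"
proof -
  have "conv (indicator F) (indicator A) x = (\<Sum>\<^sub>\<infinity>f\<in>F. (indicator A (x - f) :: real))"
    unfolding conv_def by (rule infsum_cong_neutral) auto
  then show ?thesis using assms by simp
qed

text \<open>Isolating the term of \<open>0 \<in> F\<close> in the dilated tiling equation leaves \<open>indicator E - indicator A\<close> as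
  a sum of shifts of \<open>A\<close> by the vectors \<open>(1 + q k) f\<close>, where \<open>q = l * fact (card F)\<close>, and this sum does
  not depend on \<open>k\<close>.\<close>

lemma tiling_decomposition:
  assumes F: "finite F" "0 \<in> F" and l: "l \<ge> 1" and E: "periodic (scaled_lattice l) E"
    and tiling: "conv (indicator F) (indicator A) = (indicator E :: _ \<Rightarrow> real)"
  shows "\<exists>\<phi>. (\<forall>f x. 0 \<le> \<phi> f x) \<and> (\<forall>f x. \<phi> f (x + (l * fact (card F)) *\<^sub>Z f) = \<phi> f x) \<and>
    (\<forall>x. (\<Sum>f\<in>F - {0}. \<phi> f x) = indicator E x - (indicator A x :: real))"
proof (rule averages_over_dilations[where a = "indicator A"])
  define a :: "int \<times> int \<Rightarrow> int" where "a = indicator A"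
  have a: "0 \<le> a x \<and> a x \<le> 1" for x by (simp add: a_def indicator_def)
  have ind: "real_of_int (a x) = indicator A x" for x by (simp add: a_def indicator_def)
  have sum1: "real_of_int (dilate_sum F 1 a x) = indicator E x" for x
    using fun_cong[OF tiling, of x] by (simp add: conv_indicator F dilate_sum_def ind)
  have "(indicator E (x + l *\<^sub>Z v) :: real) = indicator E x" for x v
    using E unfolding periodic_def scaled_lattice_def by blast
  then have inv: "scale_invariant l (dilate_sum F 1 a)"
    unfolding scale_invariant_def sum1[symmetric] of_int_eq_iff by blast
  fix k :: nat and x
  have "(\<Sum>f\<in>F. indicator A (x - (1 + l * fact (card F) * int k) *\<^sub>Z f)) = (indicator E x :: real)"
    using sum1[of x] unfolding tiling_dilation[OF F(1) a inv l, of k x, symmetric]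
    by (simp add: dilate_sum_def ind)
  moreover have "t *\<^sub>Z 0 = 0" for t by (simp add: zscale_def zero_prod_def)
  ultimately show "(\<Sum>f\<in>F - {0}. indicator A (x - (1 + l * fact (card F) * int k) *\<^sub>Z f))
      = (indicator E x - indicator A x :: real)"
    using sum.remove[OF F, of "\<lambda>f. indicator A (x - (1 + l * fact (card F) * int k) *\<^sub>Z f) :: real"]
    by simp
qed (use F in \<open>auto simp: indicator_def\<close>)

text \<open>Collecting the functions of parallel elements of \<open>F\<close> puts \<open>indicator E - indicator A\<close> into the
  form of \<open>invariant_decomposition\<close>. On a coset of \<open>\<Lambda>\<close> the set \<open>E\<close> is everything or nothing, so the
  periodicity of the difference passes to \<open>A\<close>.\<close>

lemma tiling_periodic_on_cosets:
  assumes F: "finite F" "0 \<in> F" and l: "l \<ge> 1" and E: "periodic (scaled_lattice l) E"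
    and tiling: "conv (indicator F) (indicator A) = (indicator E :: _ \<Rightarrow> real)"
    and R: "R \<subseteq> F - {0}" "R \<noteq> {}" "\<And>f. f \<in> F - {0} \<Longrightarrow> \<exists>r\<in>R. cross f r = 0"
    and K0: "\<And>f. f \<in> F - {0} \<Longrightarrow> gcd (fst f) (snd f) dvd K0"
    and K1: "\<And>u v. u \<in> R \<Longrightarrow> v \<in> R \<Longrightarrow> u \<noteq> v \<Longrightarrow> cross u v dvd K1"
  shows "\<exists>h\<in>R. periodic (cyclic_span ((l * (fact (card F) * K0 * K1 * fact (2 ^ card F))) *\<^sub>Z h))
    (A \<inter> (+) x ` scaled_lattice (l * (fact (card F) * K0 * K1)))"
proof -
  let ?q = "l * fact (card F)"
  obtain \<phi> where \<phi>: "\<And>f x. 0 \<le> \<phi> f x" "\<And>f x. \<phi> f (x + ?q *\<^sub>Z f) = \<phi> f x"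
    "\<And>x. (\<Sum>f\<in>F - {0}. \<phi> f x) = indicator E x - (indicator A x :: real)"
    using tiling_decomposition[OF F l E tiling] by metis
  obtain rep where rep: "\<And>f. f \<in> F - {0} \<Longrightarrow> rep f \<in> R \<and> cross f (rep f) = 0"
    using R(3) by metis
  define \<Phi> where "\<Phi> h x = (\<Sum>f | f \<in> F - {0} \<and> rep f = h. \<phi> f x)" for h x
  have finR: "finite R" using R(1) F(1) by (meson finite_Diff finite_subset)
  have sum_\<Phi>: "(\<Sum>h\<in>R. \<Phi> h x) = indicator E x - indicator A x" for x
    unfolding \<Phi>_def \<phi>(3)[symmetric] using F(1) finR rep by (intro sum.group image_subsetI) blast+
  interpret invariant_decomposition R \<Phi> "?q * K0" K1
  proof
    show "0 \<le> \<Phi> h x" for h x unfolding \<Phi>_def by (intro sum_nonneg \<phi>(1))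
    show "\<Phi> h (x + (?q * K0) *\<^sub>Z h) = \<Phi> h x" if "h \<in> R" for h x
      unfolding \<Phi>_def
    proof (rule sum.cong[OF refl])
      fix f assume "f \<in> {f. f \<in> F - {0} \<and> rep f = h}"
      then have f: "f \<in> F - {0}" "cross f h = 0" using rep[of f] by (simp_all only: mem_Collect_eq)
      then obtain k where "K0 *\<^sub>Z h = k *\<^sub>Z f" using parallel_multiple K0 by blast
      then have "(?q * K0) *\<^sub>Z h = k *\<^sub>Z ?q *\<^sub>Z f"
        by (metis mult.commute zscale_zscale)
      then show "\<phi> f (x + (?q * K0) *\<^sub>Z h) = \<phi> f x"
        using invariant_zscale[of "\<phi> f" "?q *\<^sub>Z f"] \<phi>(2) by simp
    qed
    \<comment> \<open>The difference of two indicator functions is \<open>-1\<close>, \<open>0\<close> or \<open>1\<close>, and a sum of nonnegative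
      functions excludes \<open>-1\<close>.\<close>
    have "indicator E x - indicator A x \<ge> (0::real)" for x
      unfolding \<phi>(3)[symmetric] by (intro sum_nonneg \<phi>(1))
    then show "(\<Sum>h\<in>R. \<Phi> h x) \<in> {0, 1}" for x
      unfolding sum_\<Phi> by (auto simp: indicator_def split: if_splits)
  qed (use K1 finR in auto)
  have "card R \<le> card F" using R(1) F(1) by (intro card_mono) auto
  from sum_periodic_on_coset[OF R(2) this, of x] obtain h where h: "h \<in> R"
    "\<And>v. (\<Sum>g\<in>R. \<Phi> g (x + (?q * K0 * K1) *\<^sub>Z v + fact (2 ^ card F) *\<^sub>Z (?q * K0 * K1) *\<^sub>Z h))
      = (\<Sum>g\<in>R. \<Phi> g (x + (?q * K0 * K1) *\<^sub>Z v))"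
    by blast
  let ?\<Lambda> = "(+) x ` scaled_lattice (l * (fact (card F) * K0 * K1))"
  let ?w = "(l * (fact (card F) * K0 * K1 * fact (2 ^ card F))) *\<^sub>Z h"
  have w: "fact (2 ^ card F) *\<^sub>Z (?q * K0 * K1) *\<^sub>Z h = ?w"
    by (simp add: zscale_zscale ac_simps)
  have w_E: "?w = l *\<^sub>Z (fact (card F) * K0 * K1 * fact (2 ^ card F)) *\<^sub>Z h"
    and w_\<Lambda>: "?w = (l * (fact (card F) * K0 * K1)) *\<^sub>Z fact (2 ^ card F) *\<^sub>Z h"
    by (simp_all add: zscale_zscale ac_simps)
  have \<Lambda>: "y + ?w \<in> ?\<Lambda> \<longleftrightarrow> y \<in> ?\<Lambda>" for y
  proof
    assume "y \<in> ?\<Lambda>"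
    then obtain v where "y = x + (l * (fact (card F) * K0 * K1)) *\<^sub>Z v"
      by (auto simp: scaled_lattice_def)
    then have "y + ?w = x + (l * (fact (card F) * K0 * K1)) *\<^sub>Z (v + fact (2 ^ card F) *\<^sub>Z h)"
      unfolding w_\<Lambda> by (simp add: zscale_add_right add.assoc)
    then show "y + ?w \<in> ?\<Lambda>" by (auto simp: scaled_lattice_def)
  next
    assume "y + ?w \<in> ?\<Lambda>"
    then obtain v where "y + ?w = x + (l * (fact (card F) * K0 * K1)) *\<^sub>Z v"
      by (auto simp: scaled_lattice_def)
    then have "y = x + (l * (fact (card F) * K0 * K1)) *\<^sub>Z (v - fact (2 ^ card F) *\<^sub>Z h)"
      unfolding w_\<Lambda> by (simp add: zscale_def prod_eq_iff algebra_simps)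
    then show "y \<in> ?\<Lambda>" by (auto simp: scaled_lattice_def)
  qed
  have "y + ?w \<in> A \<longleftrightarrow> y \<in> A" if "y \<in> ?\<Lambda>" for y
  proof -
    obtain v where y: "y = x + (?q * K0 * K1) *\<^sub>Z v"
      using \<open>y \<in> ?\<Lambda>\<close> by (auto simp: scaled_lattice_def mult.assoc)
    have "(indicator E (y + ?w) - indicator A (y + ?w) :: real) = indicator E y - indicator A y"
      using h(2)[of v] unfolding sum_\<Phi> w y .
    moreover have "y + ?w \<in> E \<longleftrightarrow> y \<in> E"
      using E unfolding periodic_scaled_lattice_iff w_E by blast
    ultimately show ?thesis by (auto simp: indicator_def split: if_splits)
  qed
  then have "periodic (cyclic_span ?w) (A \<inter> ?\<Lambda>)"
    using \<Lambda> by (intro periodic_cyclic_spanI) blast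
  then show ?thesis using h(1) by blast
qed

theorem theorem1p4:
  fixes n :: nat
  assumes "n \<ge> 2"
  shows "\<exists>C::real. C > 0 \<and>
    (\<forall>(F :: (int \<times> int) set) (l :: int) (E :: (int \<times> int) set).
      finite F \<longrightarrow> card F = n \<longrightarrow> 0 \<in> F \<longrightarrow> l \<ge> 1 \<longrightarrow> periodic (scaled_lattice l) E \<longrightarrow>
      (\<exists>(\<Lambda> :: (int \<times> int) set) (m :: nat) (h :: nat \<Rightarrow> int \<times> int) (L :: int).
        finite_index_subgroup \<Lambda> (scaled_lattice l) \<and>
        real (subgroup_index (scaled_lattice l) \<Lambda>) \<le> C * diam F ^ (2 * (card F - 1)\<^sup>2) \<and>
        1 \<le> m \<and> m \<le> card F - 1 \<and>
        (\<forall>j\<in>{1..m}. h j \<noteq> 0) \<and>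
        (\<forall>i\<in>{1..m}. \<forall>j\<in>{1..m}. i \<noteq> j \<longrightarrow> \<not> commensurable (h i) (h j)) \<and>
        (\<forall>j\<in>{1..m}. norm (emb (h j)) \<le> diam F ^ (card F - 1)) \<and>
        (\<forall>j\<in>{1..m}. \<exists>f\<in>F - {0}. \<exists>k::int. h j = k *\<^sub>Z f) \<and>
        L > 0 \<and> real_of_int L \<le> C * diam F ^ (card F * (card F - 1)) \<and>
        (\<forall>A :: (int \<times> int) set. conv (indicator F) (indicator A) = indicator E \<longrightarrow>
          (\<forall>x. \<exists>j\<in>{1..m}.
            periodic (cyclic_span ((l * L) *\<^sub>Z h j)) (A \<inter> (+) x ` \<Lambda>)))))"
proof -
  define C :: real where "C = (fact n * fact (2 ^ n))\<^sup>2"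
  have fact_ge_1': "(1::real) \<le> fact k" for k :: nat by (rule fact_ge_1)
  have fn: "(fact n)\<^sup>2 \<le> C" "fact n * fact (2 ^ n) \<le> C"
  proof -
    have one: "1 \<le> fact n * (fact (2 ^ n) :: real)" using mult_mono[OF fact_ge_1' fact_ge_1'] by simp
    have "fact n \<le> fact n * (fact (2 ^ n) :: real)" using fact_ge_1'[of "2 ^ n"] by simp
    then show "(fact n)\<^sup>2 \<le> C" unfolding C_def by (rule power_mono) simp
    show "fact n * fact (2 ^ n) \<le> C" unfolding C_def using one by (rule self_le_power) simp
  qed
  have "C > 0" by (simp add: C_def)
  moreover have "\<exists>(\<Lambda> :: (int \<times> int) set) (m :: nat) (h :: nat \<Rightarrow> int \<times> int) (L :: int).
        finite_index_subgroup \<Lambda> (scaled_lattice l) \<and>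
        real (subgroup_index (scaled_lattice l) \<Lambda>) \<le> C * diam F ^ (2 * (card F - 1)\<^sup>2) \<and>
        1 \<le> m \<and> m \<le> card F - 1 \<and>
        (\<forall>j\<in>{1..m}. h j \<noteq> 0) \<and>
        (\<forall>i\<in>{1..m}. \<forall>j\<in>{1..m}. i \<noteq> j \<longrightarrow> \<not> commensurable (h i) (h j)) \<and>
        (\<forall>j\<in>{1..m}. norm (emb (h j)) \<le> diam F ^ (card F - 1)) \<and>
        (\<forall>j\<in>{1..m}. \<exists>f\<in>F - {0}. \<exists>k::int. h j = k *\<^sub>Z f) \<and>
        L > 0 \<and> real_of_int L \<le> C * diam F ^ (card F * (card F - 1)) \<and>
        (\<forall>A :: (int \<times> int) set. conv (indicator F) (indicator A) = indicator E \<longrightarrow>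
          (\<forall>x. \<exists>j\<in>{1..m}.
            periodic (cyclic_span ((l * L) *\<^sub>Z h j)) (A \<inter> (+) x ` \<Lambda>)))"
    if F: "finite F" "card F = n" "0 \<in> F" and l: "l \<ge> 1" and E: "periodic (scaled_lattice l) E"
    for F :: "(int \<times> int) set" and l E
  proof -
    define d where "d = diam F"
    have card_F0: "card (F - {0}) = n - 1" using F by simp
    obtain R where R: "R \<subseteq> F - {0}" "pairwise (\<lambda>u v. cross u v \<noteq> 0) R"
      "\<forall>f\<in>F - {0}. \<exists>r\<in>R. cross f r = 0"
      using parallel_representatives[of "F - {0}"] F(1) by auto
    have finR: "finite R" using R(1) F(1) by (meson finite_Diff finite_subset)
    have "F - {0} \<noteq> {}" using card_F0 assms by force
    then have "R \<noteq> {}" using R(3) by auto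
    define m where "m = card R"
    have m: "1 \<le> m" "m \<le> n - 1"
      unfolding m_def using finR \<open>R \<noteq> {}\<close> card_mono[OF _ R(1)] F(1) card_F0
      by (auto simp: Suc_le_eq card_gt_0_iff)
    obtain h where h: "bij_betw h {1..m} R"
      using ex_bij_betw_nat_finite_1[OF finR] unfolding m_def by blast
    have hR: "h j \<in> R" if "j \<in> {1..m}" for j using h that by (auto simp: bij_betw_def)
    have le_d: "norm (emb f) \<le> d" if "f \<in> F" for f
      unfolding d_def by (rule norm_emb_le_diam) (use F that in auto)
    have d: "1 \<le> d"
    proof -
      obtain r where "r \<in> R" using \<open>R \<noteq> {}\<close> by blast
      then have "r \<in> F" "r \<noteq> 0" using R(1) by auto
      then show ?thesis using le_d[of r] one_le_norm_emb[of r] by linarith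
    qed
    \<comment> \<open>\<open>K0\<close> times an element of \<open>F\<close> is a multiple of every parallel element of \<open>F - {0}\<close>, and \<open>K1\<close> serves
      all pairs of directions. With at most \<open>n - 1\<close> directions their product is bounded by the power \<open>(n - 1) + (n - 1) (n - 2) = (n - 1)\<^sup>2\<close>
      of the diameter.\<close>
    define K0 where "K0 = (\<Prod>f\<in>F - {0}. gcd (fst f) (snd f))"
    have K0_dvd: "gcd (fst f) (snd f) dvd K0" if "f \<in> F - {0}" for f
      unfolding K0_def by (rule dvd_prodI) (use F that in auto)
    have "K0 > 0" unfolding K0_def by (intro prod_pos) (auto simp: prod_eq_iff)
    have "real_of_int K0 = (\<Prod>f\<in>F - {0}. real_of_int (gcd (fst f) (snd f)))" by (simp add: K0_def)
    also have "\<dots> \<le> (\<Prod>f\<in>F - {0}. d)"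
    proof (intro prod_mono conjI)
      fix f assume "f \<in> F - {0}"
      then show "real_of_int (gcd (fst f) (snd f)) \<le> d"
        using gcd_le_norm_emb[of f] le_d[of f] by simp
    qed simp
    finally have K0_le: "real_of_int K0 \<le> d ^ (n - 1)" by (simp add: card_F0)
    obtain K1 where K1: "K1 > 0" "\<forall>u\<in>R. \<forall>v\<in>R. u \<noteq> v \<longrightarrow> cross u v dvd K1"
      "real_of_int K1 \<le> d ^ (m * (m - 1))"
      using common_multiple_of_crosses[OF finR R(2), of d] le_d R(1) unfolding m_def by auto
    have K01: "real_of_int (K0 * K1) \<le> d ^ ((n - 1)\<^sup>2)"
    proof -
      have "real_of_int (K0 * K1) \<le> d ^ (n - 1) * d ^ (m * (m - 1))"
        using K0_le K1(1,3) d by (auto intro!: mult_mono)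
      also have "\<dots> = d ^ (n - 1 + m * (m - 1))" by (simp add: power_add)
      also have "\<dots> \<le> d ^ (n - 1 + (n - 1) * (n - 2))"
        using m d by (intro power_increasing add_left_mono mult_mono) auto
      also have "n - 1 + (n - 1) * (n - 2) = (n - 1)\<^sup>2"
      proof -
        obtain k where "n = Suc (Suc k)" using assms by (metis add_2_eq_Suc le_Suc_ex)
        then show ?thesis by (simp add: power2_eq_square)
      qed
      finally show ?thesis .
    qed
    define B where "B = fact n * K0 * K1"
    define L where "L = B * fact (2 ^ n)"
    have "B > 0" using \<open>K0 > 0\<close> K1(1) by (simp add: B_def)
    have "L > 0" using \<open>B > 0\<close> by (simp add: L_def)
    have B_le: "real_of_int B \<le> fact n * d ^ ((n - 1)\<^sup>2)"
      using mult_left_mono[OF K01, of "fact n"] by (simp add: B_def mult.assoc)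
    have "real (subgroup_index (scaled_lattice l) (scaled_lattice (l * B))) \<le> (real_of_int B)\<^sup>2"
      by (rule index_scaled_lattice_le[OF \<open>B > 0\<close>])
    also have "\<dots> \<le> (fact n * d ^ ((n - 1)\<^sup>2))\<^sup>2" using B_le \<open>B > 0\<close> by (intro power_mono) auto
    also have "\<dots> = (fact n)\<^sup>2 * d ^ (2 * (n - 1)\<^sup>2)"
      by (simp add: power_mult_distrib power_mult[symmetric] mult.commute)
    also have "\<dots> \<le> C * d ^ (2 * (n - 1)\<^sup>2)" using fn(1) d by (intro mult_right_mono) auto
    finally have index: "real (subgroup_index (scaled_lattice l) (scaled_lattice (l * B)))
        \<le> C * d ^ (2 * (n - 1)\<^sup>2)" .
    have "real_of_int L = real_of_int B * fact (2 ^ n)" by (simp add: L_def)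
    also have "\<dots> \<le> fact n * d ^ ((n - 1)\<^sup>2) * fact (2 ^ n)" using B_le by (intro mult_right_mono) auto
    also have "\<dots> \<le> C * d ^ ((n - 1)\<^sup>2)"
      using mult_right_mono[OF fn(2), of "d ^ ((n - 1)\<^sup>2)"] d by (simp add: ac_simps)
    also have "\<dots> \<le> C * d ^ (n * (n - 1))"
      using \<open>C > 0\<close> d by (intro mult_left_mono power_increasing) (auto simp: power2_eq_square)
    finally have L_le: "real_of_int L \<le> C * d ^ (n * (n - 1))" .
    have incomm: "\<not> commensurable (h i) (h j)" if "i \<in> {1..m}" "j \<in> {1..m}" "i \<noteq> j" for i j
    proof -
      have "h i \<noteq> h j" using inj_onD[OF bij_betw_imp_inj_on[OF h], of i j] that by blast
      then show ?thesis
        unfolding commensurable_iff_cross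
        using pairwiseD[OF R(2) hR[OF that(1)] hR[OF that(2)]] by simp
    qed
    have norm: "norm (emb (h j)) \<le> d ^ (n - 1)" if "j \<in> {1..m}" for j
    proof -
      have "norm (emb (h j)) \<le> d" by (rule le_d) (use hR[OF that] R(1) in blast)
      also have "\<dots> \<le> d ^ (n - 1)" using d assms by (intro self_le_power) auto
      finally show ?thesis .
    qed
    have mult: "\<exists>f\<in>F - {0}. \<exists>k::int. h j = k *\<^sub>Z f" if "j \<in> {1..m}" for j
    proof (intro bexI exI)
      show "h j = 1 *\<^sub>Z h j" by simp
      show "h j \<in> F - {0}" using hR[OF that] R(1) by blast
    qed
    have "\<exists>j\<in>{1..m}. periodic (cyclic_span ((l * L) *\<^sub>Z h j)) (A \<inter> (+) x ` scaled_lattice (l * B))"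
      if tiling: "conv (indicator F) (indicator A) = indicator E" for A x
    proof -
      have "\<exists>r\<in>R. periodic (cyclic_span ((l * L) *\<^sub>Z r)) (A \<inter> (+) x ` scaled_lattice (l * B))"
        unfolding L_def B_def F(2)[symmetric]
      proof (rule tiling_periodic_on_cosets[OF F(1,3) l E tiling R(1) \<open>R \<noteq> {}\<close>])
        show "\<exists>r\<in>R. cross f r = 0" if "f \<in> F - {0}" for f using R(3) that by (rule bspec)
        show "gcd (fst f) (snd f) dvd K0" if "f \<in> F - {0}" for f using that by (rule K0_dvd)
        show "cross u v dvd K1" if "u \<in> R" "v \<in> R" "u \<noteq> v" for u v using K1(2) that by blast
      qed
      then obtain r where r: "r \<in> R"
        "periodic (cyclic_span ((l * L) *\<^sub>Z r)) (A \<inter> (+) x ` scaled_lattice (l * B))" ..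
      obtain j where "j \<in> {1..m}" "r = h j"
        using r(1) bij_betw_imp_surj_on[OF h] by blast
      then show ?thesis using r(2) by blast
    qed
    moreover have "\<forall>j\<in>{1..m}. h j \<noteq> 0" using hR R(1) by blast
    ultimately show ?thesis
      unfolding F(2) d_def[symmetric]
      using finite_index_scaled_lattice[OF \<open>B > 0\<close>] index m incomm norm mult \<open>L > 0\<close> L_le
      by (intro exI[of _ "scaled_lattice (l * B)"] exI[of _ m] exI[of _ h] exI[of _ L] conjI ballI impI)
        simp_all
  qed
  ultimately show ?thesis by blast
qed

end
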